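(* For every integer $m\ge1$ let $C(m)=\frac{1}{m!}\int_0^\pi \frac{\theta^{m}}{2}\cot\left(\frac{\theta}{2}\right)d\theta$. Then for every integer $k\ge 0$, $$C(2k+1)=-\sum_{l=0}^k 2^{2l+1}\frac{\pi^{2k-2l}}{(2k-2l)!}\int_{[0,1]^{l+1}}\frac{\log(x_0)}{\sqrt{1-\prod_{i=0}^{l}x_i^2}}\prod_{i=1}^{l}\frac{\log(x_i)}{1-\prod_{m=1}^i x_m^2}\,dx_0\,dx_1\cdots dx_l,$$ $$C(2k+2)=\sum_{l=0}^k \frac{\pi^{2k-2l}}{(2k-2l+1)!}\int_{[0,1]^{l+1}}\arcsin^2\!\left(\sqrt{\prod_{i=0}^{l}x_i}\right)\frac{1}{x_0}\prod_{i=1}^{l}\left(\frac{\log(x_i)}{1-\prod_{m=1}^i x_m}\cdot\frac{1}{x_i}\right)dx_0\,dx_1\cdots dx_l .$$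
   Context: Empty products equal $1$. $[0,1]^{r}$ denotes the unit cube in $\mathbb{R}^{r}$. *)

theory Defs
  imports "HOL-Analysis.Analysis"
begin

definition C :: "nat \<Rightarrow> real" where
  "C m = 1 / fact m * (LBINT \<theta>:{0..pi}. \<theta> ^ m / 2 * cot (\<theta> / 2))"

text \<open>
  Points of \<open>\<real>\<^sup>l\<^sup>+\<^sup>1\<close>, with coordinates \<open>x\<^sub>0, \<dots>, x\<^sub>l\<close>, are extensional functions on \<open>{..l}\<close>;
  Lebesgue measure on that space is the product measure \<open>lebesgue_pow l\<close>.
\<close>

abbreviation lebesgue_pow :: "nat \<Rightarrow> (nat \<Rightarrow> real) measure" where
  "lebesgue_pow l \<equiv> Pi\<^sub>M {..l} (\<lambda>_. lborel)"

abbreviation unit_cube :: "nat \<Rightarrow> (nat \<Rightarrow> real) set" where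
  "unit_cube l \<equiv> PiE {..l} (\<lambda>_. {0..1})"

text \<open>
  On the cube, the conventions \<open>ln 0 = 0\<close> and \<open>a / 0 = 0\<close> affect the two integrands below
  only on a null set (some coordinate equal to 0 or 1). The same holds for \<open>cot 0 = 0\<close> in \<open>C\<close>.
\<close>

definition odd_integrand :: "nat \<Rightarrow> (nat \<Rightarrow> real) \<Rightarrow> real" where
  "odd_integrand l x =
     ln (x 0) / sqrt (1 - (\<Prod>i=0..l. (x i)\<^sup>2))
       * (\<Prod>i=1..l. ln (x i) / (1 - (\<Prod>m=1..i. (x m)\<^sup>2)))"

definition even_integrand :: "nat \<Rightarrow> (nat \<Rightarrow> real) \<Rightarrow> real" where
  "even_integrand l x =
     (arcsin (sqrt (\<Prod>i=0..l. x i)))\<^sup>2 * (1 / x 0)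
       * (\<Prod>i=1..l. ln (x i) / (1 - (\<Prod>m=1..i. x m)) * (1 / x i))"

end

(*
  Let r = 1 in the odd case and r = 2 in the even case, and a_m = 1/(2m+r)^2. Write e_k(n) for the
  elementary symmetric function of a_0, ..., a_(n-1) and h_l(n) for the complete homogeneous
  symmetric function of a_n, a_(n+1), ....

  Solving (1 - x^2) f'' - x f' = g by power series gives
  arcsin^(2k+r)(x) / (2k+r)! = sum_n b_n e_k(n) x^(2n+r) with b_n independent of k.
  With x = sin(theta/2), termwise integration against cot(theta/2)/2 turns x^(2n+r) into 1/(2n+r), so
  C(2k+r) = 2^(2k+r) sum_n b_n e_k(n) / (2n+r). On the other side, expanding the arcsine factor and
  then integrating out x_l, ..., x_1 by geometric series shows that the cube integrals are, up to sign
  and a power of 2, sum_n b_n h_l(n) / (2n+r). The two are linked by the identity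
  e_k(n) = sum_l (-1)^l e_(k-l)(infinity) h_l(n), where e_j(infinity) is the power of pi over a
  factorial in the theorem; it is found by letting x tend to 1 in the arcsine series.
*)

theory Submission
  imports Defs "HOL-Real_Asymp.Real_Asymp"
begin

section \<open>Elementary and complete homogeneous symmetric functions\<close>

text \<open>The linking identity is the coefficient of t^k in prod_(m<n) (1 + a_m t) = prod_m (1 +
  a_m t) * prod_(m>=n) 1/(1 + a_m t); the last product supplies the sign (-1)^l. The full product is
  cosh(pi sqrt(t)/2) for r = 1 and sinh(pi sqrt(t)/2)/(pi sqrt(t)/2) for r = 2, whence the values
  e_j(infinity). The integrands can be singular on faces of the cube, so all termwise integrations
  take place for [0,infinity]-valued integrals: up to one global sign, each integrand is a series of
  nonnegative terms, and on the cube its value and its integrability come out together. Alternating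
  signs enter only through the finite sum over l, after integration. Both parities share one kernel
  with exponent s = 2/r. Since s m + 1 = (2m + r)/r, integration produces the weights r^2 a_m, the
  source of the powers of 2 in the even case.\<close>

primrec esym :: "(nat \<Rightarrow> real) \<Rightarrow> nat \<Rightarrow> nat \<Rightarrow> real" where
  "esym a 0 n = 1"
| "esym a (Suc k) n = (\<Sum>m<n. a m * esym a k m)"

text \<open>\<open>esym\<close> recurses on the largest index \<open>m\<close> and continues
  strictly below it, so indices are distinct; \<open>htail\<close> recurses on the smallest index
  \<open>n + j\<close> and continues from \<open>n + j\<close> itself, so repetitions are allowed.
  Integrating out one variable of the cube produces the second pattern.\<close>

primrec htail :: "(nat \<Rightarrow> real) \<Rightarrow> nat \<Rightarrow> nat \<Rightarrow> real" where
  "htail a 0 n = 1"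
| "htail a (Suc l) n = (\<Sum>j. a (n + j) * htail a l (n + j))"

lemma esym_nonneg: "(\<And>m. 0 \<le> a m) \<Longrightarrow> 0 \<le> esym a k n"
  by (induction k arbitrary: n) (auto intro!: sum_nonneg)

lemma esym_mono:
  assumes "\<And>m. 0 \<le> a m" "m \<le> n"
  shows "esym a k m \<le> esym a k n"
  using assms by (cases k) (auto intro!: sum_mono2 mult_nonneg_nonneg esym_nonneg)

lemma esym_le:
  assumes "\<And>m. 0 \<le> a m" "summable a"
  shows "esym a k n \<le> suminf a ^ k"
proof (induction k arbitrary: n)
  case (Suc k)
  have "esym a (Suc k) n \<le> (\<Sum>m<n. a m * suminf a ^ k)"
    using Suc assms by (auto intro!: sum_mono mult_left_mono)
  also have "\<dots> = (\<Sum>m<n. a m) * suminf a ^ k"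
    by (simp add: sum_distrib_right)
  also have "\<dots> \<le> suminf a * suminf a ^ k"
    using assms by (intro mult_right_mono sum_le_suminf zero_le_power suminf_nonneg) auto
  finally show ?case by simp
qed simp

text \<open>Bounds and summability are intertwined: the bound at level \<open>l\<close> makes the
  series defining level \<open>Suc l\<close> converge, without which its \<open>suminf\<close> would
  carry no information.\<close>

lemma htail_bounds:
  assumes "\<And>m. 0 \<le> a m" "summable a"
  shows "0 \<le> htail a l n \<and> htail a l n \<le> suminf a ^ l"
    and "summable (\<lambda>j. a (n + j) * htail a l (n + j))"
proof -
  have sm: "summable (\<lambda>j. a (n + j))" for n
    using assms(2) summable_iff_shift[of a n] by (simp add: add.commute)
  have smm: "summable (\<lambda>j. a (n + j) * htail a l (n + j))"
    if "\<And>n. 0 \<le> htail a l n \<and> htail a l n \<le> suminf a ^ l" for l n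
  proof (rule summable_comparison_test')
    show "summable (\<lambda>j. a (n + j) * suminf a ^ l)"
      using sm by (rule summable_mult2)
    show "norm (a (n + j) * htail a l (n + j)) \<le> a (n + j) * suminf a ^ l" for j
      using that[of "n + j"] assms(1)[of "n + j"] by (simp add: abs_mult mult_left_mono)
  qed
  have *: "0 \<le> htail a l n \<and> htail a l n \<le> suminf a ^ l" for l n
  proof (induction l arbitrary: n)
    case (Suc l)
    note S = smm[OF Suc]
    have "htail a (Suc l) n \<le> (\<Sum>j. a (n + j) * suminf a ^ l)"
      using Suc assms by (auto intro!: suminf_le S summable_mult2 sm mult_left_mono)
    also have "\<dots> = (\<Sum>j. a (n + j)) * suminf a ^ l"
      using sm by (rule suminf_mult2[symmetric])
    also have "(\<Sum>j. a (n + j)) \<le> suminf a"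
      using suminf_minus_initial_segment[OF assms(2), of n] sum_nonneg[of "{..<n}" a] assms(1)
      by (simp add: add.commute)
    finally have "htail a (Suc l) n \<le> suminf a ^ Suc l"
      using assms by (simp add: mult_right_mono suminf_nonneg)
    moreover have "0 \<le> htail a (Suc l) n"
      using Suc assms(1) by (auto intro!: suminf_nonneg S)
    ultimately show ?case by blast
  qed simp
  show "0 \<le> htail a l n \<and> htail a l n \<le> suminf a ^ l" by (rule *)
  show "summable (\<lambda>j. a (n + j) * htail a l (n + j))" by (rule smm[OF *])
qed

text \<open>Splits according to whether the smallest index is \<open>n\<close> or larger.\<close>

lemma htail_decompose:
  assumes "\<And>m. 0 \<le> a m" "summable a"
  shows "htail a (Suc l) n = a n * htail a l n + htail a (Suc l) (Suc n)"
  using suminf_split_head[OF htail_bounds(2)[OF assms, of n l]] by simp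

text \<open>A remainder of a convergent series; level 0 is excluded, being constantly 1.\<close>

lemma htail_tendsto_0:
  assumes "\<And>m. 0 \<le> a m" "summable a"
  shows "htail a (Suc l) \<longlonglongrightarrow> 0"
proof -
  let ?g = "\<lambda>j. a j * htail a l j"
  have g: "summable ?g" using htail_bounds(2)[OF assms, of 0 l] by simp
  have "(\<lambda>n. suminf ?g - (\<Sum>j<n. ?g j)) \<longlonglongrightarrow> suminf ?g - suminf ?g"
    using g by (intro tendsto_intros summable_LIMSEQ)
  moreover have "htail a (Suc l) = (\<lambda>n. suminf ?g - (\<Sum>j<n. ?g j))"
    using suminf_minus_initial_segment[OF g] by (simp add: add.commute fun_eq_iff)
  ultimately show ?thesis by simp
qed

lemma htail_scale:
  assumes "\<And>m. 0 \<le> a m" "summable a"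
  shows "htail (\<lambda>m. c * a m) l n = c ^ l * htail a l n"
proof (induction l arbitrary: n)
  case (Suc l)
  show ?case
    using suminf_mult[OF htail_bounds(2)[OF assms, of n l], of "c * c ^ l"]
    by (simp add: Suc mult_ac)
qed simp

text \<open>
  As functions of \<open>n\<close>, both sides satisfy \<open>D\<^sub>k\<^sub>+\<^sub>1(n + 1) - D\<^sub>k\<^sub>+\<^sub>1(n) = a\<^sub>n D\<^sub>k(n)\<close>, and
  both tend to \<open>A k\<close>.
\<close>

lemma sum_htail_eq_esym:
  assumes a: "\<And>m. 0 \<le> a m" "summable a" and A: "\<And>j. esym a j \<longlonglongrightarrow> A j"
  shows "(\<Sum>l\<le>k. (-1) ^ l * A (k - l) * htail a l n) = esym a k n"
proof (induction k arbitrary: n)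
  case 0
  have "esym a 0 = (\<lambda>_. 1)" by auto
  with A[of 0] have "A 0 = 1" by (simp add: LIMSEQ_const_iff)
  then show ?case by simp
next
  case (Suc k)
  define D where "D = (\<lambda>n. \<Sum>l\<le>Suc k. (-1) ^ l * A (Suc k - l) * htail a l n)"
  \<comment> \<open>Only the term \<open>l = 0\<close> involves \<open>A (Suc k)\<close>, and there
    \<open>htail a 0 n = 1\<close>; shifting the index exposes the minus sign.\<close>
  have D': "D n = A (Suc k) - (\<Sum>l\<le>k. (-1) ^ l * A (k - l) * htail a (Suc l) n)" for n
    unfolding D_def by (subst sum.atMost_Suc_shift) (simp add: sum_negf)
  have step: "D (Suc n) = D n + a n * esym a k n" for n
  proof -
    have "D (Suc n) - D n =
        (\<Sum>l\<le>k. (-1) ^ l * A (k - l) * (htail a (Suc l) n - htail a (Suc l) (Suc n)))"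
      by (simp only: D' right_diff_distrib sum_subtractf)
    also have "\<dots> = (\<Sum>l\<le>k. a n * ((-1) ^ l * A (k - l) * htail a l n))"
      by (intro sum.cong refl, subst htail_decompose[OF a]) (simp del: htail.simps)
    finally show ?thesis by (simp add: Suc sum_distrib_left[symmetric])
  qed
  \<comment> \<open>Equal increments make the difference constant in \<open>n\<close>; its limit 0
    then fixes the constant.\<close>
  have const: "D n - esym a (Suc k) n = D 0" for n
    by (induction n) (use step in auto)
  have "D \<longlonglongrightarrow> A (Suc k) - (\<Sum>l\<le>k. (-1) ^ l * A (k - l) * 0)"
    unfolding D' by (intro tendsto_intros htail_tendsto_0 a)
  then have "(\<lambda>n. D n - esym a (Suc k) n) \<longlonglongrightarrow> A (Suc k) - (\<Sum>l\<le>k. (-1) ^ l * A (k - l) * 0) - A (Suc k)"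
    by (intro tendsto_diff A)
  then have "D 0 = 0" unfolding const by (simp add: LIMSEQ_const_iff)
  then show ?case using const[of n] by (simp add: D_def)
qed

section \<open>Power series of powers of the arcsine\<close>

text \<open>The coefficient of x^(2n+r) in arcsin^r(x)/r!. With N = 2n+r the ratio is
  N^2/((N+2)(N+1)), which is (1 - x^2) f'' = x f' read off at x^N.\<close>

primrec arcsin_coeff :: "nat \<Rightarrow> nat \<Rightarrow> real" where
  "arcsin_coeff r 0 = 1 / fact r"
| "arcsin_coeff r (Suc n) =
     real (2 * n + r) ^ 2 / (real (2 * n + r + 2) * real (2 * n + r + 1)) * arcsin_coeff r n"

definition inv_square :: "nat \<Rightarrow> nat \<Rightarrow> real" where
  "inv_square r m = 1 / real (2 * m + r) ^ 2"

text \<open>The candidate for arcsin^(2k+r)(x)/(2k+r)!, written down first and identified in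
  \<open>eval_arcsin_fps\<close>. The guard \<open>r \<le> N\<close> protects against truncated
  subtraction.\<close>

definition arcsin_fps :: "nat \<Rightarrow> nat \<Rightarrow> real fps" where
  "arcsin_fps r k = Abs_fps (\<lambda>N. if r \<le> N \<and> even (N - r)
     then arcsin_coeff r ((N - r) div 2) * esym (inv_square r) k ((N - r) div 2) else 0)"

lemma inv_square_nonneg: "0 \<le> inv_square r m"
  by (simp add: inv_square_def)

lemma summable_inv_square: "summable (inv_square r)"
proof (rule summable_comparison_test_ev)
  show "summable (\<lambda>m. 1 / real m ^ 2)"
    using inverse_power_summable[of 2, where 'a = real] by (simp add: inverse_eq_divide)
  show "\<forall>\<^sub>F m in sequentially. norm (inv_square r m) \<le> 1 / real m ^ 2"
    using eventually_gt_at_top[of 0]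
    by eventually_elim (auto simp: inv_square_def intro!: divide_left_mono power_mono)
qed

lemma arcsin_coeff_nonneg: "0 \<le> arcsin_coeff r n"
  by (induction n) simp_all

lemma arcsin_coeff_le_1: "arcsin_coeff r n \<le> 1"
proof (induction n)
  case (Suc n)
  let ?q = "real (2 * n + r) ^ 2 / (real (2 * n + r + 2) * real (2 * n + r + 1))"
  have "real (2 * n + r) ^ 2 \<le> real (2 * n + r + 2) * real (2 * n + r + 1)"
    unfolding power2_eq_square by (intro mult_mono) auto
  then have "?q \<le> 1" by (subst divide_le_eq_1_pos) (simp_all del: of_nat_add)
  then have "?q * arcsin_coeff r n \<le> 1 * 1"
    using Suc arcsin_coeff_nonneg by (intro mult_mono) auto
  then show ?case by simp
qed (simp add: fact_ge_1)

lemma arcsin_fps_nth: "fps_nth (arcsin_fps r k) (2 * n + r) = arcsin_coeff r n * esym (inv_square r) k n"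
  by (simp add: arcsin_fps_def)

lemma arcsin_fps_nth_eq_0:
  assumes "\<And>n. N \<noteq> 2 * n + r"
  shows "fps_nth (arcsin_fps r k) N = 0"
proof -
  have "\<not> (r \<le> N \<and> even (N - r))"
  proof
    assume *: "r \<le> N \<and> even (N - r)"
    then obtain n where "N - r = 2 * n" by (elim conjE evenE)
    with * assms[of n] show False by simp
  qed
  then show ?thesis by (auto simp: arcsin_fps_def)
qed

text \<open>The coefficients are bounded in \<open>N\<close>, so a geometric series dominates.
  Radius 1 suffices for the arguments sin u with |u| < pi/2.\<close>

lemma fps_conv_radius_arcsin: "1 \<le> fps_conv_radius (arcsin_fps r k)"
  unfolding fps_conv_radius_def
proof (rule conv_radius_geI_ex')
  fix t :: real assume t: "0 < t" "ereal t < 1"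
  define M where "M = suminf (inv_square r) ^ k"
  have M: "0 \<le> M"
    unfolding M_def by (intro zero_le_power suminf_nonneg summable_inv_square inv_square_nonneg)
  have "\<bar>fps_nth (arcsin_fps r k) N\<bar> \<le> M" for N
  proof -
    have "arcsin_coeff r n * esym (inv_square r) k n \<le> 1 * M" for n
      unfolding M_def
      by (intro mult_mono arcsin_coeff_le_1 esym_le inv_square_nonneg summable_inv_square
          esym_nonneg) simp
    then show ?thesis
      using M by (auto simp: arcsin_fps_def abs_mult arcsin_coeff_nonneg esym_nonneg inv_square_nonneg)
  qed
  then have "norm (fps_nth (arcsin_fps r k) N * of_real t ^ N) \<le> M * t ^ N" for N
    using t by (auto simp: abs_mult intro!: mult_right_mono)
  moreover have "summable (\<lambda>N. M * t ^ N)"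
    using t by (intro summable_mult summable_geometric) simp
  ultimately show "summable (\<lambda>N. fps_nth (arcsin_fps r k) N * of_real t ^ N)"
    by (rule summable_comparison_test'[rotated])
qed

text \<open>
  The differential equation \<open>(1 - x\<^sup>2) f'' - x f' = g\<close>, on the level of coefficients, where
  \<open>g\<close> is the previous power of the arcsine.
\<close>

lemma arcsin_fps_recurrence:
  assumes "r = 1 \<or> r = 2"
  shows "real (N + 2) * real (N + 1) * fps_nth (arcsin_fps r k) (N + 2)
      - real N ^ 2 * fps_nth (arcsin_fps r k) N =
    (case k of 0 \<Rightarrow> (if r = 2 \<and> N = 0 then 1 else 0) | Suc k' \<Rightarrow> fps_nth (arcsin_fps r k') N)"
proof (cases "\<exists>n. N = 2 * n + r")
  case True
  then obtain n where N: "N = 2 * n + r" by blast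
  define b b' p e where "b = arcsin_coeff r n" and "b' = arcsin_coeff r (Suc n)"
    and "p = real (N + 2) * real (N + 1)" and "e = esym (inv_square r) k"
  have N0: "real N \<noteq> 0" using assms by (auto simp: N)
  have c: "p * b' = real N ^ 2 * b"
    by (simp add: N p_def b_def b'_def del: of_nat_add of_nat_Suc)
  have f: "fps_nth (arcsin_fps r k) (N + 2) = b' * e (Suc n)" "fps_nth (arcsin_fps r k) N = b * e n"
    using arcsin_fps_nth[of r k "Suc n"] arcsin_fps_nth[of r k n]
    by (simp_all add: N b_def b'_def e_def del: arcsin_coeff.simps esym.simps)
  have "p * fps_nth (arcsin_fps r k) (N + 2) - real N ^ 2 * fps_nth (arcsin_fps r k) N =
      (p * b') * e (Suc n) - real N ^ 2 * b * e n"
    by (simp only: f mult.assoc)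
  \<comment> \<open>For \<open>k > 0\<close> the increment \<open>e (Suc n) - e n\<close> is
    \<open>inv_square r n\<close>, that is 1/N^2, times the next lower symmetric function. The
    cancellation against \<open>real N ^ 2\<close> dictates the choice of a_m.\<close>
  also have "\<dots> = real N ^ 2 * b * (e (Suc n) - e n)"
    unfolding c by (simp only: right_diff_distrib)
  also have "\<dots> = (case k of 0 \<Rightarrow> 0 | Suc k' \<Rightarrow> fps_nth (arcsin_fps r k') N)"
    using N0 by (cases k) (simp_all add: arcsin_fps_nth N inv_square_def b_def e_def)
  finally show ?thesis using N0 by (cases k) (auto simp: p_def)
next
  case False
  then have 0: "fps_nth (arcsin_fps r k') N = 0" for k' by (auto intro: arcsin_fps_nth_eq_0)
  show ?thesis
  proof (cases "r = 2 \<and> N = 0")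
    \<comment> \<open>The only case where \<open>N + 2\<close> is an exponent of the series but
      \<open>N\<close> is not: the first exponent 2, with coefficient 1/2 for \<open>k = 0\<close>
      and 0 otherwise.\<close>
    case True
    then show ?thesis
      using arcsin_fps_nth[of r k 0] 0 by (cases k) (simp_all add: fact_numeral)
  next
    case N: False
    have "N + 2 \<noteq> 2 * n + r" for n
      using False N assms by (cases n) auto
    then show ?thesis using 0 N by (auto simp: arcsin_fps_nth_eq_0 split: nat.split)
  qed
qed

section \<open>Solving the differential equation along x = sin u\<close>

lemma abs_sin_less_1:
  assumes "\<bar>u\<bar> < pi / 2"
  shows "\<bar>sin u\<bar> < 1"
proof -
  have "0 < cos u" using assms by (intro cos_gt_zero_pi) auto
  then have "0 < cos u ^ 2" by simp
  then have "sin u ^ 2 < 1" using sin_cos_squared_add[of u] by linarith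
  then show ?thesis by (simp add: abs_square_less_1)
qed

text \<open>Along x = sin u the operator (1 - x^2) F'' - x F' is the second derivative of F(sin u)
  in u. So F(sin u) and \<open>\<phi>\<close> have the same second derivative, and the values at u =
  0 remove both constants of integration.\<close>

lemma fps_sin_substitution:
  fixes F :: "real fps" and \<phi> \<phi>' \<phi>'' :: "real \<Rightarrow> real"
  assumes rad: "1 \<le> fps_conv_radius F"
    and \<phi>: "\<And>u. (\<phi> has_field_derivative \<phi>' u) (at u)" "\<And>u. (\<phi>' has_field_derivative \<phi>'' u) (at u)"
    and init: "fps_nth F 0 = \<phi> 0" "fps_nth F 1 = \<phi>' 0"
    and ode: "\<And>u. \<bar>u\<bar> < pi / 2 \<Longrightarrow>
      (\<lambda>N. (real (N + 2) * real (N + 1) * fps_nth F (N + 2) - real N ^ 2 * fps_nth F N) * sin u ^ N)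
        sums \<phi>'' u"
    and u: "\<bar>u\<bar> < pi / 2"
  shows "eval_fps F (sin u) = \<phi> u" "eval_fps (fps_deriv F) (sin u) * cos u = \<phi>' u"
proof -
  let ?F' = "fps_deriv F" and ?S = "{- (pi / 2)<..<pi / 2}"
  let ?F'' = "fps_deriv ?F'"
  have sin_rad: "ereal (norm (sin u)) < fps_conv_radius F" if "u \<in> ?S" for u
  proof -
    have "ereal (norm (sin u)) < 1" using abs_sin_less_1[of u] that by auto
    with rad show ?thesis by (rule less_le_trans[rotated])
  qed
  have rad': "fps_conv_radius F \<le> fps_conv_radius ?F'" "fps_conv_radius F \<le> fps_conv_radius ?F''"
    using fps_conv_radius_deriv[of F] fps_conv_radius_deriv[of ?F'] by (auto intro: order_trans)
  have sr: "ereal (norm (sin u)) < fps_conv_radius F" "ereal (norm (sin u)) < fps_conv_radius ?F'"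
      "ereal (norm (sin u)) < fps_conv_radius ?F''" if "u \<in> ?S" for u
    using sin_rad[OF that] rad' by (auto intro: less_le_trans)
  have G: "(1 - sin u ^ 2) * eval_fps ?F'' (sin u) - sin u * eval_fps ?F' (sin u) = \<phi>'' u"
    if "u \<in> ?S" for u
  proof -
    have X: "(\<lambda>N. real N * fps_nth F N * sin u ^ N) sums (sin u * eval_fps ?F' (sin u))"
    proof -
      have "(\<lambda>N. real (Suc N) * fps_nth F (Suc N) * sin u ^ Suc N) sums (sin u * eval_fps ?F' (sin u))"
        using sums_mult[OF sums_eval_fps[OF sr(2)[OF that]], of "sin u"] by (simp add: mult_ac)
      from sums_Suc[OF this] show ?thesis by simp
    qed
    have X2: "(\<lambda>N. real N * real (N - 1) * fps_nth F N * sin u ^ N) sums (sin u ^ 2 * eval_fps ?F'' (sin u))"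
    proof -
      define g where "g = (\<lambda>N. real N * real (N - 1) * fps_nth F N * sin u ^ N)"
      have "(\<lambda>N. g (Suc (Suc N))) sums (sin u ^ 2 * eval_fps ?F'' (sin u))"
        using sums_mult[OF sums_eval_fps[OF sr(3)[OF that]], of "sin u ^ 2"]
        by (simp add: g_def mult_ac power2_eq_square)
      from sums_Suc[of "\<lambda>N. g (Suc N)", OF this] have "(\<lambda>N. g (Suc N)) sums (sin u ^ 2 * eval_fps ?F'' (sin u))"
        by (simp add: g_def)
      from sums_Suc[OF this] show ?thesis by (simp add: g_def)
    qed
    have X0: "(\<lambda>N. real (N + 2) * real (N + 1) * fps_nth F (N + 2) * sin u ^ N) sums eval_fps ?F'' (sin u)"
      using sums_eval_fps[OF sr(3)[OF that]] by (simp add: mult_ac)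
    \<comment> \<open>Splits N^2 into the weights of x^2 F'' and x F'; at \<open>N = 0\<close> the
      truncated \<open>N - 1\<close> is harmless because of the factor N.\<close>
    have sq: "real N ^ 2 = real N * real (N - 1) + real N" for N
      by (cases N) (simp_all add: power2_eq_square algebra_simps)
    have "(\<lambda>N. (real (N + 2) * real (N + 1) * fps_nth F (N + 2) - real N ^ 2 * fps_nth F N) * sin u ^ N)
        sums (eval_fps ?F'' (sin u) - sin u ^ 2 * eval_fps ?F'' (sin u) - sin u * eval_fps ?F' (sin u))"
      using sums_diff[OF sums_diff[OF X0 X2] X] unfolding sq
      by (rule back_subst[where P = "\<lambda>f. f sums _"]) (simp add: fun_eq_iff algebra_simps)
    moreover have "\<bar>u\<bar> < pi / 2" using that by auto
    ultimately show ?thesis using sums_unique2[OF ode] by (fastforce simp: left_diff_distrib)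
  qed
  have "\<exists>c. \<forall>u\<in>?S. eval_fps ?F' (sin u) * cos u - \<phi>' u = c"
  proof (rule has_field_derivative_zero_constant)
    fix u assume u: "u \<in> ?S"
    have "((\<lambda>u. eval_fps ?F' (sin u) * cos u - \<phi>' u) has_field_derivative
        (eval_fps ?F'' (sin u) * cos u * cos u + eval_fps ?F' (sin u) * (- sin u)) - \<phi>'' u) (at u within ?S)"
      by (rule derivative_eq_intros DERIV_chain2[OF has_field_derivative_eval_fps] sr(2)[OF u]
          has_field_derivative_at_within[OF \<phi>(2)] refl | simp)+
    also have "(eval_fps ?F'' (sin u) * cos u * cos u + eval_fps ?F' (sin u) * (- sin u)) - \<phi>'' u = 0"
      using G[OF u] cos_squared_eq[of u] by (simp only: mult.assoc power2_eq_square) (simp add: algebra_simps)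
    finally show "((\<lambda>u. eval_fps ?F' (sin u) * cos u - \<phi>' u) has_field_derivative 0) (at u within ?S)" .
  qed simp
  then obtain c where c: "eval_fps ?F' (sin u) * cos u - \<phi>' u = c" if "u \<in> ?S" for u by blast
  have "c = 0" using c[of 0] init by (simp add: eval_fps_at_0)
  with c have d: "eval_fps ?F' (sin u) * cos u = \<phi>' u" if "u \<in> ?S" for u using that by fastforce
  have "\<exists>c. \<forall>u\<in>?S. eval_fps F (sin u) - \<phi> u = c"
  proof (rule has_field_derivative_zero_constant)
    fix u assume u: "u \<in> ?S"
    have "((\<lambda>u. eval_fps F (sin u) - \<phi> u) has_field_derivative
        eval_fps ?F' (sin u) * cos u - \<phi>' u) (at u within ?S)"
      by (rule derivative_eq_intros DERIV_chain2[OF has_field_derivative_eval_fps] sr(1)[OF u]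
          has_field_derivative_at_within[OF \<phi>(1)] refl | simp)+
    then show "((\<lambda>u. eval_fps F (sin u) - \<phi> u) has_field_derivative 0) (at u within ?S)"
      using d[OF u] by simp
  qed simp
  then obtain c' where c': "eval_fps F (sin u) - \<phi> u = c'" if "u \<in> ?S" for u by blast
  have "c' = 0" using c'[of 0] init by (simp add: eval_fps_at_0)
  with c' have "eval_fps F (sin u) = \<phi> u" if "u \<in> ?S" for u using that by fastforce
  moreover have "u \<in> ?S" using u by auto
  ultimately show "eval_fps F (sin u) = \<phi> u" "eval_fps ?F' (sin u) * cos u = \<phi>' u" using d by blast+
qed

lemma power_div_fact_derivative:
  "((\<lambda>u. u ^ Suc q / fact (Suc q)) has_field_derivative u ^ q / fact q) (at (u :: real))"
  by (rule derivative_eq_intros refl | simp)+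

text \<open>Induction on \<open>k\<close>: by the coefficient recurrence, the second derivative in u
  at level \<open>Suc k\<close> is the series of level \<open>k\<close>, which the induction
  hypothesis evaluates.\<close>

lemma eval_arcsin_fps:
  assumes r: "r = 1 \<or> r = 2" and u: "\<bar>u\<bar> < pi / 2"
  shows "eval_fps (arcsin_fps r k) (sin u) = u ^ (2 * k + r) / fact (2 * k + r)
    \<and> eval_fps (fps_deriv (arcsin_fps r k)) (sin u) * cos u = u ^ (2 * k + r - 1) / fact (2 * k + r - 1)"
  using u
proof (induction k arbitrary: u)
  case 0
  \<comment> \<open>The second derivative of u^r/r!, matching the exceptional constant in
    \<open>arcsin_fps_recurrence\<close>.\<close>
  define \<phi>'' :: "real \<Rightarrow> real" where "\<phi>'' = (\<lambda>_. if r = 2 then 1 else 0)"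
  define \<phi> \<phi>' :: "real \<Rightarrow> real" where "\<phi> = (\<lambda>u. u ^ r / fact r)" and "\<phi>' = (\<lambda>u. u ^ (r - 1) / fact (r - 1))"
  have 1: "(\<phi> has_field_derivative \<phi>' u) (at u)" for u
  proof -
    have "Suc (r - 1) = r" using r by auto
    then show ?thesis using power_div_fact_derivative[of "r - 1"] by (simp only: \<phi>_def \<phi>'_def)
  qed
  have 2: "(\<phi>' has_field_derivative \<phi>'' u) (at u)" for u
    using r by (auto simp: \<phi>'_def \<phi>''_def)
  have 3: "fps_nth (arcsin_fps r 0) 0 = \<phi> 0"
    using r by (auto simp: arcsin_fps_def \<phi>_def)
  have 4: "fps_nth (arcsin_fps r 0) 1 = \<phi>' 0"
    using r by (auto simp: arcsin_fps_def \<phi>'_def)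
  have 5: "(\<lambda>N. (real (N + 2) * real (N + 1) * fps_nth (arcsin_fps r 0) (N + 2)
      - real N ^ 2 * fps_nth (arcsin_fps r 0) N) * sin u ^ N) sums \<phi>'' u" for u
  proof -
    have "(\<lambda>N. if N = 0 then \<phi>'' u * sin u ^ N else 0) sums (\<phi>'' u * sin u ^ 0)"
      by (rule sums_single)
    also have "(\<lambda>N. if N = 0 then \<phi>'' u * sin u ^ N else 0) =
        (\<lambda>N. (if r = 2 \<and> N = 0 then 1 else 0) * sin u ^ N)"
      by (auto simp: \<phi>''_def)
    finally show ?thesis unfolding arcsin_fps_recurrence[OF r] by simp
  qed
  show ?case
    using fps_sin_substitution[OF fps_conv_radius_arcsin 1 2 3 4 5 0] by (auto simp: \<phi>_def \<phi>'_def)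
next
  case (Suc k)
  define q where "q = 2 * k + r"
  have q: "0 < q" "2 * Suc k + r = Suc (Suc q)" using r by (auto simp: q_def)
  have 3: "fps_nth (arcsin_fps r (Suc k)) 0 = 0 ^ Suc (Suc q) / fact (Suc (Suc q))"
    using r by (auto simp: arcsin_fps_def)
  have 4: "fps_nth (arcsin_fps r (Suc k)) 1 = 0 ^ Suc q / fact (Suc q)"
    using r by (auto simp: arcsin_fps_def)
  have 5: "(\<lambda>N. (real (N + 2) * real (N + 1) * fps_nth (arcsin_fps r (Suc k)) (N + 2)
      - real N ^ 2 * fps_nth (arcsin_fps r (Suc k)) N) * sin u ^ N) sums (u ^ q / fact q)"
    if "\<bar>u\<bar> < pi / 2" for u
  proof -
    have "ereal (norm (sin u)) < 1" using abs_sin_less_1[OF that] by simp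
    then have "ereal (norm (sin u)) < fps_conv_radius (arcsin_fps r k)"
      by (rule less_le_trans) (rule fps_conv_radius_arcsin)
    then show ?thesis
      using sums_eval_fps[of "sin u" "arcsin_fps r k"] Suc.IH[OF that]
      unfolding arcsin_fps_recurrence[OF r] by (simp add: q_def)
  qed
  from fps_sin_substitution[OF fps_conv_radius_arcsin power_div_fact_derivative
      power_div_fact_derivative 3 4 5 Suc.prems]
  show ?case by (simp only: q(2) diff_Suc_1 simp_thms)
qed

text \<open>Reindexing discards the vanishing coefficients. The first series serves \<open>C\<close>
  and the squared arcsine; the second, its derivative in u, serves the inverse square root and the
  limit of \<open>esym\<close>.\<close>

lemma sums_arcsin:
  assumes r: "r = 1 \<or> r = 2" and u: "\<bar>u\<bar> < pi / 2"
  shows "(\<lambda>n. arcsin_coeff r n * esym (inv_square r) k n * sin u ^ (2 * n + r))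
      sums (u ^ (2 * k + r) / fact (2 * k + r))" (is ?A)
    and "(\<lambda>n. arcsin_coeff r n * real (2 * n + r) * esym (inv_square r) k n * sin u ^ (2 * n + r - 1) * cos u)
      sums (u ^ (2 * k + r - 1) / fact (2 * k + r - 1))" (is ?B)
proof -
  let ?F = "arcsin_fps r k"
  have "ereal (norm (sin u)) < 1" using abs_sin_less_1[OF u] by simp
  then have rad: "ereal (norm (sin u)) < fps_conv_radius ?F"
    by (rule less_le_trans) (rule fps_conv_radius_arcsin)
  then have rad': "ereal (norm (sin u)) < fps_conv_radius (fps_deriv ?F)"
    by (rule less_le_trans) (rule fps_conv_radius_deriv)
  have "(\<lambda>n. fps_nth ?F (2 * n + r) * sin u ^ (2 * n + r)) sums eval_fps ?F (sin u)"
    using sums_eval_fps[OF rad]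
    by (subst sums_mono_reindex[where g = "\<lambda>n. 2 * n + r"])
      (auto simp: strict_mono_def intro!: arcsin_fps_nth_eq_0)
  then show ?A
    using eval_arcsin_fps[OF r u, of k] by (simp add: arcsin_fps_nth)
  have Suc: "Suc (2 * n + r - 1) = 2 * n + r" for n using r by auto
  have "(\<lambda>n. fps_nth (fps_deriv ?F) (2 * n + r - 1) * sin u ^ (2 * n + r - 1)) sums eval_fps (fps_deriv ?F) (sin u)"
  proof (subst sums_mono_reindex[where g = "\<lambda>n. 2 * n + r - 1"])
    show "strict_mono (\<lambda>n. 2 * n + r - 1)" using r by (auto simp: strict_mono_def)
    show "fps_nth (fps_deriv ?F) N * sin u ^ N = 0" if "N \<notin> range (\<lambda>n. 2 * n + r - 1)" for N
    proof -
      have "N + 1 \<noteq> 2 * n + r" for n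
      proof
        assume "N + 1 = 2 * n + r"
        then have "N = 2 * n + r - 1" by simp
        with that show False by blast
      qed
      then show ?thesis by (simp add: arcsin_fps_nth_eq_0)
    qed
    show "(\<lambda>N. fps_nth (fps_deriv ?F) N * sin u ^ N) sums eval_fps (fps_deriv ?F) (sin u)"
      by (rule sums_eval_fps[OF rad'])
  qed
  then have "(\<lambda>n. real (2 * n + r) * fps_nth ?F (2 * n + r) * sin u ^ (2 * n + r - 1)) sums eval_fps (fps_deriv ?F) (sin u)"
    by (simp only: fps_deriv_nth Suc_eq_plus1[symmetric] Suc)
  from sums_mult2[OF this, of "cos u"] show ?B
    using eval_arcsin_fps[OF r u, of k] unfolding arcsin_fps_nth by (simp add: mult_ac)
qed

text \<open>
  An Abelian argument: divide the derivative series of \<open>arcsin\<^sup>2\<^sup>k\<^sup>+\<^sup>r\<close> by that of \<open>arcsin\<^sup>r\<close>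
  and let the argument tend to 1, where the latter diverges.
\<close>

lemma esym_inv_square_tendsto:
  assumes r: "r = 1 \<or> r = 2"
  shows "esym (inv_square r) k \<longlonglongrightarrow> (pi / 2) ^ (2 * k) * fact (r - 1) / fact (2 * k + r - 1)"
proof -
  define A where "A = (pi / 2) ^ (2 * k) * fact (r - 1) / fact (2 * k + r - 1)"
  let ?e = "esym (inv_square r) k"
  define w where "w = (\<lambda>n. arcsin_coeff r n * real (2 * n + r))"
  \<comment> \<open>Weights on the indices \<open>n\<close>: nonnegative, of total mass
    \<open>p (r - 1) u\<close>, each tending to 0 as u tends to pi/2 because of
    \<open>cos u\<close>. All mass escapes to large \<open>n\<close>, so the weighted mean of
    \<open>esym\<close> approaches its limit.\<close>
  define t where "t = (\<lambda>u n. w n * sin u ^ (2 * n + r - 1) * cos u)"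
  define p where "p = (\<lambda>q (u::real). u ^ q / fact q)"
  have exp: "2 * k + r - 1 = 2 * k + (r - 1)" using r by auto
  have pA: "p (2 * k + r - 1) (pi / 2) = A * p (r - 1) (pi / 2)" and p0: "0 < p (r - 1) (pi / 2)"
    unfolding p_def A_def exp by (simp_all add: power_add)
  have cont: "(p q \<longlongrightarrow> p q (pi / 2)) (at_left (pi / 2))" for q
    unfolding p_def by (intro tendsto_intros) simp
  have w0: "0 \<le> w n" for n by (simp add: w_def arcsin_coeff_nonneg)
  have ev: "eventually (\<lambda>u. 0 < u \<and> u < pi / 2) (at_left (pi / 2))"
    using eventually_at_left_field[of _ "pi / 2"] by (auto intro!: exI[of _ 0])
  have S: "(\<lambda>n. ?e n * t u n) sums p (2 * k + r - 1) u" "t u sums p (r - 1) u"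
    "\<And>n. 0 \<le> t u n" "\<And>n. t u n \<le> w n * cos u" if "0 < u \<and> u < pi / 2" for u
  proof -
    have u: "\<bar>u\<bar> < pi / 2" using that by auto
    have sc: "0 \<le> sin u" "sin u \<le> 1" "0 \<le> cos u"
      using that by (auto intro!: sin_ge_zero cos_ge_zero)
    show "(\<lambda>n. ?e n * t u n) sums p (2 * k + r - 1) u"
      using sums_arcsin(2)[OF r u, of k] by (simp add: t_def w_def p_def mult_ac)
    show "t u sums p (r - 1) u"
      using sums_arcsin(2)[OF r u, of 0] by (simp add: t_def w_def p_def mult_ac)
    show "0 \<le> t u n" for n using sc w0 by (simp add: t_def)
    have "w n * sin u ^ (2 * n + r - 1) \<le> w n * 1" for n
      using sc w0 by (intro mult_left_mono power_le_one) auto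
    then show "t u n \<le> w n * cos u" for n
      using sc unfolding t_def by (intro mult_right_mono) auto
  qed
  \<comment> \<open>From index \<open>M\<close> on, monotonicity bounds \<open>esym\<close> below by
    its value at \<open>M\<close>; the mass of the first \<open>M\<close> indices is at most a
    constant times \<open>cos u\<close> and vanishes in the limit.\<close>
  have le_A: "?e M \<le> A" for M
  proof -
    have "?e M * (p (r - 1) u - cos u * (\<Sum>n<M. w n)) \<le> p (2 * k + r - 1) u" if u: "0 < u \<and> u < pi / 2" for u
    proof -
      have "(\<lambda>n. if n \<in> {..<M} then t u n else 0) sums (\<Sum>n<M. t u n)"
        by (rule sums_If_finite_set) simp
      then have sums: "(\<lambda>n. ?e M * (t u n - (if n \<in> {..<M} then t u n else 0))) sums (?e M * (p (r - 1) u - (\<Sum>n<M. t u n)))"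
        using S(2)[OF u] by (intro sums_mult sums_diff)
      have "?e M * (t u n - (if n \<in> {..<M} then t u n else 0)) \<le> ?e n * t u n" for n
        using S(3)[OF u, of n]
        by (cases "n < M") (auto intro!: mult_right_mono esym_mono mult_nonneg_nonneg esym_nonneg inv_square_nonneg)
      from sums_le[OF this sums S(1)[OF u]]
      have "?e M * (p (r - 1) u - (\<Sum>n<M. t u n)) \<le> p (2 * k + r - 1) u" .
      moreover have "(\<Sum>n<M. t u n) \<le> cos u * (\<Sum>n<M. w n)"
        using S(4)[OF u] by (auto simp: sum_distrib_left mult.commute intro!: sum_mono)
      then have "?e M * (p (r - 1) u - cos u * (\<Sum>n<M. w n)) \<le> ?e M * (p (r - 1) u - (\<Sum>n<M. t u n))"
        by (intro mult_left_mono esym_nonneg inv_square_nonneg) simp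
      ultimately show ?thesis by linarith
    qed
    then have "eventually (\<lambda>u. ?e M * (p (r - 1) u - cos u * (\<Sum>n<M. w n)) \<le> p (2 * k + r - 1) u) (at_left (pi / 2))"
      using ev by (auto elim: eventually_mono)
    moreover have "((\<lambda>u. ?e M * (p (r - 1) u - cos u * (\<Sum>n<M. w n))) \<longlongrightarrow>
        ?e M * (p (r - 1) (pi / 2) - cos (pi / 2) * (\<Sum>n<M. w n))) (at_left (pi / 2))"
      by (intro tendsto_intros cont)
    ultimately have "?e M * (p (r - 1) (pi / 2) - cos (pi / 2) * (\<Sum>n<M. w n)) \<le> p (2 * k + r - 1) (pi / 2)"
      by (intro tendsto_le[OF _ cont]) auto
    then have "?e M * p (r - 1) (pi / 2) \<le> A * p (r - 1) (pi / 2)" by (simp only: pA cos_pi_half) simp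
    then show ?thesis using p0 by (rule mult_right_le_imp_le)
  qed
  \<comment> \<open>A weighted mean is at most any upper bound of the sequence.\<close>
  have ge_A: "A \<le> L" if "\<And>n. ?e n \<le> L" for L
  proof -
    have "p (2 * k + r - 1) u \<le> L * p (r - 1) u" if u: "0 < u \<and> u < pi / 2" for u
      using sums_le[OF _ S(1)[OF u] sums_mult[OF S(2)[OF u], of L]] S(3)[OF u] \<open>\<And>n. ?e n \<le> L\<close>
      by (auto intro: mult_right_mono)
    then have "eventually (\<lambda>u. p (2 * k + r - 1) u \<le> L * p (r - 1) u) (at_left (pi / 2))"
      using ev by (auto elim: eventually_mono)
    then have "p (2 * k + r - 1) (pi / 2) \<le> L * p (r - 1) (pi / 2)"
      by (intro tendsto_le[OF _ tendsto_mult_left[OF cont] cont]) auto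
    then show ?thesis using p0 unfolding pA by (rule mult_right_le_imp_le)
  qed
  have "incseq ?e" by (auto simp: incseq_def intro: esym_mono inv_square_nonneg)
  then obtain L where L: "?e \<longlonglongrightarrow> L" "\<And>n. ?e n \<le> L"
    using incseq_convergent[of ?e A] le_A by blast
  have "L = A"
    using ge_A[OF L(2)] LIMSEQ_le_const2[OF L(1), of A] le_A by (intro antisym) auto
  with L show ?thesis by (simp add: A_def)
qed

section \<open>The cotangent integrals\<close>

text \<open>Since h <= tan h on (0, pi/2), one power of theta absorbs the singularity of the
  cotangent at 0; this is where \<open>1 \<le> m\<close> enters.\<close>

lemma set_integrable_power_cot:
  assumes "1 \<le> m"
  shows "set_integrable lborel {0..pi} (\<lambda>\<theta>. \<theta> ^ m / 2 * cot (\<theta> / 2))"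
  unfolding set_integrable_def
proof (rule integrableI_bounded_set_indicator[where B = "pi ^ (m - 1)"])
  show "AE \<theta> in lborel. \<theta> \<in> {0..pi} \<longrightarrow> norm (\<theta> ^ m / 2 * cot (\<theta> / 2)) \<le> pi ^ (m - 1)"
  proof (intro AE_I2 impI)
    fix \<theta> :: real assume \<theta>: "\<theta> \<in> {0..pi}"
    have "\<bar>\<theta> / 2 * cot (\<theta> / 2)\<bar> \<le> 1"
    proof (cases "\<theta> = 0 \<or> \<theta> = pi")
      case False
      with \<theta> have h: "0 < \<theta> / 2" "\<theta> / 2 < pi / 2" by auto
      then have "\<theta> / 2 \<le> tan (\<theta> / 2)" "0 < tan (\<theta> / 2)"
        using abs_tan_ge[of "\<theta> / 2"] tan_gt_zero[of "\<theta> / 2"] by auto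
      then show ?thesis using h by (simp add: cot_altdef abs_mult divide_simps)
    qed (auto simp: cot_def)
    then have "\<theta> ^ (m - 1) * \<bar>\<theta> / 2 * cot (\<theta> / 2)\<bar> \<le> pi ^ (m - 1) * 1"
      using \<theta> by (intro mult_mono power_mono) auto
    moreover have "\<theta> ^ m = \<theta> ^ (m - 1) * \<theta>" using assms by (cases m) auto
    ultimately show "norm (\<theta> ^ m / 2 * cot (\<theta> / 2)) \<le> pi ^ (m - 1)"
      using \<theta> by (simp add: abs_mult mult_ac)
  qed
qed (simp_all add: cot_def)

lemma nn_integral_sin_power_cos:
  assumes "0 < N"
  shows "(\<integral>\<^sup>+\<theta>\<in>{0..pi}. ennreal (sin (\<theta> / 2) ^ (N - 1) * cos (\<theta> / 2) / 2) \<partial>lborel) = ennreal (1 / real N)"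
proof -
  have "(\<integral>\<^sup>+\<theta>\<in>{0..pi}. ennreal (sin (\<theta> / 2) ^ (N - 1) * cos (\<theta> / 2) / 2) \<partial>lborel)
      = ennreal (sin (pi / 2) ^ N / real N - sin (0 / 2) ^ N / real N)"
  proof (rule nn_integral_FTC_Icc)
    fix \<theta> :: real assume \<theta>: "\<theta> \<in> {0..pi}"
    show "((\<lambda>\<theta>. sin (\<theta> / 2) ^ N / real N) has_real_derivative sin (\<theta> / 2) ^ (N - 1) * cos (\<theta> / 2) / 2) (at \<theta>)"
      using assms by (auto intro!: derivative_eq_intros)
    show "0 \<le> sin (\<theta> / 2) ^ (N - 1) * cos (\<theta> / 2) / 2"
      using \<theta> by (auto intro!: mult_nonneg_nonneg zero_le_power sin_ge_zero cos_ge_zero)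
  qed auto
  with assms show ?thesis by (simp add: zero_power)
qed

text \<open>The terms are nonnegative on [0, pi], so the expansion can be integrated termwise before
  the resulting series is known to converge.\<close>

lemma sums_C:
  assumes r: "r = 1 \<or> r = 2"
  shows "(\<lambda>n. 2 ^ (2 * k + r) * (arcsin_coeff r n * esym (inv_square r) k n / real (2 * n + r)))
    sums C (2 * k + r)"
proof -
  define q where "q = 2 * k + r"
  define v where "v = (\<lambda>n. 2 ^ q * (arcsin_coeff r n * esym (inv_square r) k n / real (2 * n + r)))"
  define f where "f = (\<lambda>\<theta>. indicator {0..pi} \<theta> *\<^sub>R (\<theta> ^ q / 2 * cot (\<theta> / 2)))"
  define h :: "nat \<Rightarrow> real \<Rightarrow> real" where "h = (\<lambda>n \<theta>. sin (\<theta> / 2) ^ (2 * n + r - 1) * cos (\<theta> / 2) / 2)"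
  \<comment> \<open>\<open>2 ^ q\<close> compensates for passing from theta to u = theta/2.\<close>
  define c where "c = (\<lambda>n. 2 ^ q * (arcsin_coeff r n * esym (inv_square r) k n))"
  have c0: "0 \<le> c n" for n
    by (simp add: c_def arcsin_coeff_nonneg esym_nonneg inv_square_nonneg)
  have v0: "0 \<le> v n" for n
    by (simp add: v_def arcsin_coeff_nonneg esym_nonneg inv_square_nonneg)
  have f: "integrable lborel f"
    using set_integrable_power_cot[of q] r unfolding set_integrable_def f_def q_def by auto
  have f0: "0 \<le> f \<theta>" for \<theta>
  proof (cases "\<theta> \<in> {0..pi}")
    case True
    then have "0 \<le> sin (\<theta> / 2)" "0 \<le> cos (\<theta> / 2)" by (auto intro!: sin_ge_zero cos_ge_zero)
    with True show ?thesis by (simp add: f_def cot_def)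
  qed (simp add: f_def)
  \<comment> \<open>theta = pi means u = pi/2, outside the range of the series; at theta = 0 the
    default \<open>cot 0 = 0\<close> clashes with the nonzero term \<open>n = 0\<close> when
    \<open>r = 1\<close> and \<open>k = 0\<close>.\<close>
  have expand: "ennreal (f \<theta> / fact q) = (\<Sum>n. ennreal (c n) * (ennreal (h n \<theta>) * indicator {0..pi} \<theta>))"
    if "\<theta> \<noteq> 0" "\<theta> \<noteq> pi" for \<theta>
  proof (cases "\<theta> \<in> {0..pi}")
    case True
    with that have \<theta>: "0 < \<theta>" "\<theta> < pi" by auto
    then have "0 < sin (\<theta> / 2)" "0 < cos (\<theta> / 2)" by (auto intro!: sin_gt_zero cos_gt_zero)
    have h0: "0 \<le> h n \<theta>" for n
      unfolding h_def using \<open>0 < sin (\<theta> / 2)\<close> \<open>0 < cos (\<theta> / 2)\<close> by simp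
    have hn: "sin (\<theta> / 2) ^ (2 * n + r) * (cot (\<theta> / 2) / 2) = h n \<theta>" for n
      using \<open>0 < sin (\<theta> / 2)\<close> r by (auto simp: h_def cot_def)
    have "(\<lambda>n. arcsin_coeff r n * esym (inv_square r) k n * sin (\<theta> / 2) ^ (2 * n + r))
        sums ((\<theta> / 2) ^ q / fact q)"
      unfolding q_def using \<theta> by (intro sums_arcsin r) auto
    from sums_mult2[OF sums_mult[OF this, of "2 ^ q"], of "cot (\<theta> / 2) / 2"]
    have "(\<lambda>n. c n * (sin (\<theta> / 2) ^ (2 * n + r) * (cot (\<theta> / 2) / 2)))
        sums (2 ^ q * ((\<theta> / 2) ^ q / fact q) * (cot (\<theta> / 2) / 2))"
      by (simp only: c_def mult.assoc)
    then have "(\<lambda>n. c n * h n \<theta>) sums (f \<theta> / fact q)"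
      unfolding hn using True by (simp add: f_def power_divide mult.commute)
    then have "(\<Sum>n. ennreal (c n * h n \<theta>)) = ennreal (f \<theta> / fact q)"
      using c0 h0 by (intro suminf_ennreal_eq) auto
    with True c0 h0 show ?thesis by (simp add: ennreal_mult)
  qed (simp add: f_def)
  have "ennreal (integral\<^sup>L lborel (\<lambda>\<theta>. f \<theta> / fact q)) = (\<integral>\<^sup>+\<theta>. ennreal (f \<theta> / fact q) \<partial>lborel)"
    using f f0 by (subst nn_integral_eq_integral) auto
  also have "\<dots> = (\<integral>\<^sup>+\<theta>. (\<Sum>n. ennreal (c n) * (ennreal (h n \<theta>) * indicator {0..pi} \<theta>)) \<partial>lborel)"
  proof (rule nn_integral_cong_AE)
    have "AE \<theta> in lborel. \<theta> \<noteq> (0::real)" "AE \<theta> in lborel. \<theta> \<noteq> pi"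
      by (rule AE_lborel_singleton)+
    then show "AE \<theta> in lborel. ennreal (f \<theta> / fact q) =
        (\<Sum>n. ennreal (c n) * (ennreal (h n \<theta>) * indicator {0..pi} \<theta>))"
      by eventually_elim (rule expand)
  qed
  also have "\<dots> = (\<Sum>n. ennreal (c n) * (\<integral>\<^sup>+\<theta>\<in>{0..pi}. ennreal (h n \<theta>) \<partial>lborel))"
    unfolding h_def by (subst nn_integral_suminf) (simp_all add: nn_integral_cmult)
  also have "\<dots> = (\<Sum>n. ennreal (v n))"
  proof (intro suminf_cong)
    fix n
    have "0 < 2 * n + r" using r by auto
    then show "ennreal (c n) * (\<integral>\<^sup>+\<theta>\<in>{0..pi}. ennreal (h n \<theta>) \<partial>lborel) = ennreal (v n)"
      unfolding h_def by (subst nn_integral_sin_power_cos)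
        (simp_all add: ennreal_mult[symmetric] c0, simp add: c_def v_def)
  qed
  finally have eq: "(\<Sum>n. ennreal (v n)) = ennreal (integral\<^sup>L lborel (\<lambda>\<theta>. f \<theta> / fact q))" by simp
  \<comment> \<open>Convergence is a consequence: the series equals a finite integral.\<close>
  then have sm: "summable v" using v0 by (intro summable_suminf_not_top) auto
  have "ennreal (suminf v) = ennreal (integral\<^sup>L lborel (\<lambda>\<theta>. f \<theta> / fact q))"
    using suminf_ennreal2[OF v0 sm] eq by simp
  moreover have "0 \<le> suminf v" "0 \<le> integral\<^sup>L lborel (\<lambda>\<theta>. f \<theta> / fact q)"
    using sm v0 f0 by (auto intro!: suminf_nonneg integral_nonneg)
  ultimately have "suminf v = integral\<^sup>L lborel (\<lambda>\<theta>. f \<theta> / fact q)" by simp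
  also have "\<dots> = C q" by (simp add: C_def set_lebesgue_integral_def f_def)
  finally show ?thesis using summable_sums[OF sm] by (simp add: v_def q_def)
qed

section \<open>Integrals over the cube\<close>

text \<open>\<open>s\<close> is 2 in the odd case and 1 in the even case; the powers
  \<open>s * n\<close> stem from the n-th term of the arcsine expansion, and each logarithm is
  negated to make the kernel nonnegative on the cube.\<close>

definition log_kernel :: "nat \<Rightarrow> nat \<Rightarrow> nat \<Rightarrow> (nat \<Rightarrow> real) \<Rightarrow> real" where
  "log_kernel s n l x = (\<Prod>i=1..l. x i ^ (s * n) * (- ln (x i)) / (1 - (\<Prod>m=1..i. x m ^ s)))"

lemma nn_integral_power_ln:
  "(\<integral>\<^sup>+y\<in>{0..1}. ennreal (y ^ p * (- ln y)) \<partial>lborel) = ennreal (1 / (real p + 1) ^ 2)"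
proof -
  let ?f = "\<lambda>y::real. y ^ p * (- ln y)"
  define q where "q = real p + 1"
  \<comment> \<open>Antiderivative by parts. The fundamental theorem is applied on the open interval
    with one-sided limits, as \<open>ln\<close> is singular at 0.\<close>
  define F where "F = (\<lambda>y::real. y ^ Suc p * (1 - q * ln y) / q ^ 2)"
  have q: "0 < q" by (simp add: q_def)
  have F_alt: "F = (\<lambda>y. y ^ p * y / q ^ 2 - y ^ p * (y * ln y) / q)"
    using q by (simp add: F_def fun_eq_iff power2_eq_square field_simps)
  have ein: "einterval 0 1 = {0::real<..<1}"
    using einterval_eq(1)[of 0 1] by (simp add: zero_ereal_def one_ereal_def)
  have D: "(F has_real_derivative ?f y) (at y)" if "0 < y" for y
  proof -
    have 1: "((\<lambda>y. y ^ Suc p) has_real_derivative q * y ^ p) (at y)"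
      using DERIV_pow[of "Suc p" y UNIV] by (simp add: q_def add.commute)
    have 2: "((\<lambda>y. 1 - q * ln y) has_real_derivative - (q / y)) (at y)"
      using that by (auto intro!: derivative_eq_intros)
    have "(F has_real_derivative (q * y ^ p * (1 - q * ln y) + - (q / y) * y ^ Suc p) / q ^ 2) (at y)"
      unfolding F_def by (rule DERIV_cdivide[OF DERIV_mult[OF 1 2]])
    also have "(q * y ^ p * (1 - q * ln y) + - (q / y) * y ^ Suc p) / q ^ 2 = ?f y"
      using that q by (simp add: power2_eq_square field_simps)
    finally show ?thesis .
  qed
  have A: "(F \<longlongrightarrow> 0) (at_right 0)"
  proof -
    have "((\<lambda>y::real. y * ln y) \<longlongrightarrow> 0) (at_right 0)" by real_asymp
    then have "(F \<longlongrightarrow> 0 ^ p * 0 / q ^ 2 - 0 ^ p * 0 / q) (at_right 0)"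
      unfolding F_alt using q by (intro tendsto_intros) auto
    then show ?thesis by simp
  qed
  have B: "(F \<longlongrightarrow> 1 / q ^ 2) (at_left 1)"
  proof -
    have "(F \<longlongrightarrow> 1 ^ Suc p * (1 - q * ln 1) / q ^ 2) (at_left 1)"
      unfolding F_def using q by (intro tendsto_intros) auto
    then show ?thesis by simp
  qed
  have f0: "0 \<le> ?f y" if "0 < y" "y < 1" for y
    using that by (intro mult_nonneg_nonneg) auto
  have A': "((F \<circ> real_of_ereal) \<longlongrightarrow> 0) (at_right 0)" and B': "((F \<circ> real_of_ereal) \<longlongrightarrow> 1 / q ^ 2) (at_left 1)"
    using A B by (simp_all add: zero_ereal_def one_ereal_def ereal_tendsto_simps1)
  have D': "(F has_real_derivative ?f y) (at y)" "isCont ?f y" if "0 < ereal y" for y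
    using D[of y] that by (auto intro!: continuous_intros)
  have "AE y in lborel. 0 < ereal y \<longrightarrow> ereal y < 1 \<longrightarrow> 0 \<le> ?f y"
    using f0 by (intro AE_I2) auto
  note int = interval_integral_FTC_nonneg[OF _ D' this A' B']
  have "(\<integral>\<^sup>+y\<in>{0..1}. ennreal (?f y) \<partial>lborel) =
      (\<integral>\<^sup>+y. ennreal (indicator (einterval 0 1) y *\<^sub>R ?f y) \<partial>lborel)"
  proof (rule nn_integral_cong_AE)
    have "AE y in lborel. y \<noteq> (0::real)" "AE y in lborel. y \<noteq> (1::real)"
      by (rule AE_lborel_singleton)+
    then show "AE y in lborel. ennreal (?f y) * indicator {0..1} y =
        ennreal (indicator (einterval 0 1) y *\<^sub>R ?f y)"
      by eventually_elim (auto simp: ein indicator_def)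
  qed
  also have "\<dots> = ennreal (LINT y:einterval 0 1|lborel. ?f y)"
    unfolding set_lebesgue_integral_def
    using int(1) D' f0 by (intro nn_integral_eq_integral) (auto simp: set_integrable_def ein indicator_def)
  finally show ?thesis using int(2) by (simp add: interval_lebesgue_integral_def q_def)
qed

lemma nn_integral_power_ln_geometric:
  assumes Z: "0 \<le> Z" "Z \<le> 1" and s: "1 \<le> s"
  shows "(\<integral>\<^sup>+y\<in>{0..1}. ennreal (y ^ (s * n) * (- ln y) / (1 - Z * y ^ s)) \<partial>lborel)
    = (\<Sum>j. ennreal (Z ^ j * (1 / (real (s * (n + j)) + 1) ^ 2)))"
proof -
  have "(\<integral>\<^sup>+y\<in>{0..1}. ennreal (y ^ (s * n) * (- ln y) / (1 - Z * y ^ s)) \<partial>lborel) =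
      (\<integral>\<^sup>+y. (\<Sum>j. ennreal (Z ^ j) * (ennreal (y ^ (s * (n + j)) * (- ln y)) * indicator {0..1} y)) \<partial>lborel)"
  proof (rule nn_integral_cong_AE)
    \<comment> \<open>For \<open>Z = 1\<close> the geometric series breaks down at
      \<open>y = 1\<close>.\<close>
    have "AE y in lborel. y \<noteq> (1::real)" by (rule AE_lborel_singleton)
    then show "AE y in lborel. ennreal (y ^ (s * n) * (- ln y) / (1 - Z * y ^ s)) * indicator {0..1} y
        = (\<Sum>j. ennreal (Z ^ j) * (ennreal (y ^ (s * (n + j)) * (- ln y)) * indicator {0..1} y))"
    proof eventually_elim
      case (elim y)
      show ?case
      proof (cases "y \<in> {0..1}")
        case True
        with elim have y: "0 \<le> y" "y < 1" by auto
        have "y ^ s \<le> y" using y s by (metis less_imp_le power_decreasing power_one_right)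
        moreover have "Z * y ^ s \<le> 1 * y ^ s" using y Z by (intro mult_right_mono) auto
        ultimately have "norm (Z * y ^ s) < 1" using y Z by auto
        note geo = sums_mult[OF geometric_sums[OF this], of "y ^ (s * n) * (- ln y)"]
        have eq: "y ^ (s * n) * (- ln y) * (Z * y ^ s) ^ j = Z ^ j * (y ^ (s * (n + j)) * (- ln y))" for j
          by (simp add: distrib_left power_add power_mult[of y s j] power_mult_distrib)
        have "(\<lambda>j. Z ^ j * (y ^ (s * (n + j)) * (- ln y))) sums (y ^ (s * n) * (- ln y) / (1 - Z * y ^ s))"
          using geo by (simp only: eq) simp
        moreover have "0 \<le> - ln y" using y by (cases "y = 0") auto
        ultimately have "(\<Sum>j. ennreal (Z ^ j * (y ^ (s * (n + j)) * (- ln y)))) =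
            ennreal (y ^ (s * n) * (- ln y) / (1 - Z * y ^ s))"
          using y Z by (intro suminf_ennreal_eq mult_nonneg_nonneg) auto
        moreover have "ennreal (Z ^ j * (y ^ (s * (n + j)) * (- ln y))) =
            ennreal (Z ^ j) * ennreal (y ^ (s * (n + j)) * (- ln y))" for j
          using y Z \<open>0 \<le> - ln y\<close> by (intro ennreal_mult mult_nonneg_nonneg) auto
        ultimately show ?thesis using True by simp
      qed simp
    qed
  qed
  also have "\<dots> = (\<Sum>j. ennreal (Z ^ j) * (\<integral>\<^sup>+y\<in>{0..1}. ennreal (y ^ (s * (n + j)) * (- ln y)) \<partial>lborel))"
    by (subst nn_integral_suminf) (simp_all add: nn_integral_cmult)
  also have "\<dots> = (\<Sum>j. ennreal (Z ^ j * (1 / (real (s * (n + j)) + 1) ^ 2)))"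
    unfolding nn_integral_power_ln using Z by (subst ennreal_mult[symmetric]) auto
  finally show ?thesis .
qed

section \<open>Structure of the logarithmic kernel and iterated integration\<close>

lemma measurable_component_pow:
  "i \<le> l \<Longrightarrow> (\<lambda>x. x i) \<in> borel_measurable (lebesgue_pow l)"
  using measurable_component_singleton[of i "{..l}" "\<lambda>_. lborel"] by simp

lemma sets_unit_cube: "unit_cube l \<in> sets (lebesgue_pow l)"
  by (rule sets_PiM_I_finite) auto

lemma measurable_log_kernel: "log_kernel s n l \<in> borel_measurable (lebesgue_pow l)"
  unfolding log_kernel_def[abs_def]
  by (intro borel_measurable_prod borel_measurable_times borel_measurable_divide borel_measurable_power
      borel_measurable_uminus borel_measurable_diff borel_measurable_const borel_measurable_ln
      measurable_component_pow) auto

lemma measurable_cube_integrand: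
  fixes f :: "real \<Rightarrow> ennreal"
  assumes [measurable]: "f \<in> borel_measurable borel"
  shows "(\<lambda>x. f (x 0) * ennreal (log_kernel s n l x) * indicator (unit_cube l) x)
    \<in> borel_measurable (lebesgue_pow l)"
proof -
  note [measurable] = measurable_log_kernel sets_unit_cube measurable_component_pow[of 0 l, simplified]
  show ?thesis by measurable
qed

lemma log_kernel_nonneg:
  assumes "x \<in> unit_cube l"
  shows "0 \<le> log_kernel s n l x"
proof -
  have x: "0 \<le> x i" "x i \<le> 1" if "i \<le> l" for i
    using PiE_mem[OF assms, of i] that by auto
  have "0 \<le> - ln (x i)" if "i \<le> l" for i
    using x[OF that] by (cases "x i = 0") auto
  moreover have "(\<Prod>m=1..i. x m ^ s) \<le> 1" if "i \<le> l" for i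
    using x that by (intro prod_le_1) (auto intro!: power_le_one)
  ultimately show ?thesis
    unfolding log_kernel_def using x by (intro prod_nonneg ballI divide_nonneg_nonneg mult_nonneg_nonneg) auto
qed

text \<open>Lets the factor Z^j of a geometric series be absorbed as a shift of
  \<open>n\<close>.\<close>

lemma log_kernel_shift:
  "log_kernel s (n + j) l x = (\<Prod>m=1..l. x m ^ s) ^ j * log_kernel s n l x"
proof -
  have "(\<Prod>m=1..l. x m ^ s) ^ j = (\<Prod>m=1..l. (x m ^ s) ^ j)" by (rule prod_power_distrib)
  then show ?thesis
    by (simp only: log_kernel_def prod.distrib[symmetric])
      (intro prod.cong refl, simp add: power_add power_mult distrib_left)
qed

text \<open>The last coordinate occurs only in the last factor, so integrating from the highest
  index downward always meets the integral of \<open>nn_integral_power_ln_geometric\<close>.\<close>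

lemma log_kernel_Suc:
  "log_kernel s n (Suc l) (x(Suc l := y)) =
    log_kernel s n l x * (y ^ (s * n) * (- ln y) / (1 - (\<Prod>m=1..l. x m ^ s) * y ^ s))"
proof -
  have *: "(\<Prod>m=1..i. (x(Suc l := y)) m ^ s) = (\<Prod>m=1..i. x m ^ s)" if "i \<le> l" for i
    using that by (intro prod.cong) auto
  have "(\<Prod>i=1..l. (x(Suc l := y)) i ^ (s * n) * (- ln ((x(Suc l := y)) i)) /
      (1 - (\<Prod>m=1..i. (x(Suc l := y)) m ^ s))) = log_kernel s n l x"
    unfolding log_kernel_def by (intro prod.cong refl) (auto simp: * simp del: fun_upd_apply, auto)
  then show ?thesis
    using *[of l] by (simp add: log_kernel_def[of s n "Suc l"] del: fun_upd_apply) simp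
qed

text \<open>
  Integrating out \<open>x\<^sub>l\<close> by a geometric series turns the power \<open>s n\<close> of the remaining variables
  into \<open>s (n + j)\<close>.
\<close>

lemma nn_integral_log_kernel:
  fixes f :: "real \<Rightarrow> ennreal"
  assumes f[measurable]: "f \<in> borel_measurable borel" and s: "1 \<le> s"
  defines "a \<equiv> \<lambda>m. 1 / (real (s * m) + 1) ^ 2"
  assumes sm: "summable a"
  shows "(\<integral>\<^sup>+x\<in>unit_cube l. f (x 0) * ennreal (log_kernel s n l x) \<partial>lebesgue_pow l)
    = (\<integral>\<^sup>+t\<in>{0..1}. f t \<partial>lborel) * ennreal (htail a l n)"
proof (induction l arbitrary: n)
  case 0
  interpret product_sigma_finite "\<lambda>_::nat. lborel :: real measure" by standard
  have "(\<integral>\<^sup>+x\<in>unit_cube 0. f (x 0) * ennreal (log_kernel s n 0 x) \<partial>lebesgue_pow 0) =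
      (\<integral>\<^sup>+x. f (x 0) * indicator {0..1} (x 0) \<partial>Pi\<^sub>M {0::nat} (\<lambda>_. lborel))"
  proof -
    have "{..0::nat} = {0}" by auto
    show ?thesis unfolding \<open>{..0::nat} = {0}\<close>
    proof (rule nn_integral_cong)
      fix x assume "x \<in> space (Pi\<^sub>M {0::nat} (\<lambda>_. lborel :: real measure))"
      then have "x \<in> PiE {0} (\<lambda>_. {0..1}) \<longleftrightarrow> x 0 \<in> {0..1}"
        by (auto simp: space_PiM PiE_iff)
      then show "f (x 0) * ennreal (log_kernel s n 0 x) * indicator (PiE {0} (\<lambda>_. {0..1})) x =
          f (x 0) * indicator {0..1} (x 0)"
        by (simp add: log_kernel_def indicator_def)
    qed
  qed
  also have "\<dots> = (\<integral>\<^sup>+t\<in>{0..1}. f t \<partial>lborel)"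
    by (rule product_nn_integral_singleton[where f = "\<lambda>t. f t * indicator {0..1} t"]) simp
  finally show ?case by simp
next
  case (Suc l)
  interpret product_sigma_finite "\<lambda>_::nat. lborel :: real measure" by standard
  define I where "I = (\<integral>\<^sup>+t\<in>{0..1}. f t \<partial>lborel)"
  have a0: "0 \<le> a m" for m by (simp add: a_def)
  let ?G = "\<lambda>n l x. f (x 0) * ennreal (log_kernel s n l x) * indicator (unit_cube l) x"
  note meas = measurable_cube_integrand[OF f]
  have ins: "{..Suc l} = insert (Suc l) {..l}" by auto
  have "integral\<^sup>N (lebesgue_pow (Suc l)) (?G n (Suc l)) =
      (\<integral>\<^sup>+x. (\<integral>\<^sup>+y. ?G n (Suc l) (x(Suc l := y)) \<partial>lborel) \<partial>lebesgue_pow l)"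
    using meas[of s n "Suc l"] unfolding ins by (intro product_nn_integral_insert) auto
  also have "\<dots> = (\<integral>\<^sup>+x. (\<Sum>j. ennreal (a (n + j)) * ?G (n + j) l x) \<partial>lebesgue_pow l)"
  proof (intro nn_integral_cong)
    fix x assume "x \<in> space (lebesgue_pow l)"
    then have ext: "x \<in> extensional {..l}" by (simp add: space_PiM PiE_def)
    define Z where "Z = (\<Prod>m=1..l. x m ^ s)"
    have ind: "indicator (unit_cube (Suc l)) (x(Suc l := y)) =
        (indicator (unit_cube l) x * indicator {0..1} y :: ennreal)" for y
      using ext by (auto simp: indicator_def PiE_iff extensional_def le_Suc_eq)
    show "(\<integral>\<^sup>+y. ?G n (Suc l) (x(Suc l := y)) \<partial>lborel) = (\<Sum>j. ennreal (a (n + j)) * ?G (n + j) l x)"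
    proof (cases "x \<in> unit_cube l")
      case True
      have x: "0 \<le> x i" "x i \<le> 1" if "i \<le> l" for i
        using PiE_mem[OF True, of i] that by auto
      have Z: "0 \<le> Z" "Z \<le> 1"
        unfolding Z_def using x by (auto intro!: prod_nonneg prod_le_1 power_le_one)
      have K: "ennreal (log_kernel s n (Suc l) (x(Suc l := y))) =
          ennreal (log_kernel s n l x) * ennreal (y ^ (s * n) * (- ln y) / (1 - Z * y ^ s))" for y
        unfolding log_kernel_Suc Z_def using log_kernel_nonneg[OF True] by (rule ennreal_mult')
      have "(\<integral>\<^sup>+y. ?G n (Suc l) (x(Suc l := y)) \<partial>lborel) =
          (\<integral>\<^sup>+y. (f (x 0) * ennreal (log_kernel s n l x)) *
            (ennreal (y ^ (s * n) * (- ln y) / (1 - Z * y ^ s)) * indicator {0..1} y) \<partial>lborel)"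
        unfolding ind K using True by (intro nn_integral_cong) (simp add: mult_ac)
      also have "\<dots> = f (x 0) * ennreal (log_kernel s n l x) * (\<Sum>j. ennreal (Z ^ j * a (n + j)))"
        unfolding a_def nn_integral_power_ln_geometric[OF Z s, symmetric]
        by (intro nn_integral_cmult) measurable
      \<comment> \<open>Trading Z^j for the parameter \<open>n + j\<close> makes the induction
        hypothesis applicable term by term and brings out the recursion of
        \<open>htail\<close>.\<close>
      also have "\<dots> = (\<Sum>j. ennreal (a (n + j)) * (f (x 0) * ennreal (log_kernel s (n + j) l x)))"
        unfolding log_kernel_shift Z_def[symmetric] ennreal_suminf_cmult[symmetric]
        using Z a0 log_kernel_nonneg[OF True] by (simp add: ennreal_mult mult_ac)
      finally show ?thesis using True by simp
    qed (simp add: ind)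
  qed
  also have "\<dots> = (\<Sum>j. ennreal (a (n + j)) * (I * ennreal (htail a l (n + j))))"
    by (subst nn_integral_suminf[OF borel_measurable_times_ennreal[OF borel_measurable_const meas]])
      (simp only: nn_integral_cmult[OF meas] Suc.IH I_def)
  also have "\<dots> = I * (\<Sum>j. ennreal (a (n + j) * htail a l (n + j)))"
    using a0 htail_bounds(1)[OF a0 sm]
    by (subst ennreal_suminf_cmult[symmetric]) (simp add: ennreal_mult mult_ac)
  also have "(\<Sum>j. ennreal (a (n + j) * htail a l (n + j))) = ennreal (htail a (Suc l) n)"
    unfolding htail.simps using a0 htail_bounds[OF a0 sm] by (intro suminf_ennreal2) auto
  finally show ?case by (simp add: I_def)
qed

text \<open>Termwise integration of a nonnegative expansion of \<open>g\<close>. The total is finite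
  because \<open>htail a l\<close> is bounded in \<open>n\<close> and \<open>v\<close> is
  summable.\<close>

lemma has_bochner_integral_log_kernel_series:
  fixes \<phi> :: "nat \<Rightarrow> real \<Rightarrow> real" and v :: "nat \<Rightarrow> real"
  assumes s: "1 \<le> s"
  defines "a \<equiv> \<lambda>m. 1 / (real (s * m) + 1) ^ 2"
  assumes a: "summable a"
    and \<phi>: "\<And>n. \<phi> n \<in> borel_measurable borel" "\<And>n t. t \<in> {0..1} \<Longrightarrow> 0 \<le> \<phi> n t"
      "\<And>n. (\<integral>\<^sup>+t\<in>{0..1}. ennreal (\<phi> n t) \<partial>lborel) = ennreal (v n)"
    and v: "\<And>n. 0 \<le> v n" "summable v"
    and g: "g \<in> borel_measurable (lebesgue_pow l)"
      "AE x in lebesgue_pow l. x \<in> unit_cube l \<longrightarrow> (\<lambda>n. \<phi> n (x 0) * log_kernel s n l x) sums g x"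
  shows "has_bochner_integral (lebesgue_pow l) (\<lambda>x. indicator (unit_cube l) x *\<^sub>R g x)
      (\<Sum>n. v n * htail a l n)"
    and "summable (\<lambda>n. v n * htail a l n)"
proof -
  have a0: "0 \<le> a m" for m by (simp add: a_def)
  note h = htail_bounds(1)[OF a0 a]
  have "norm (v n * htail a l n) \<le> v n * suminf a ^ l" for n
    using h[of l n] v(1)[of n] by (simp add: abs_mult mult_left_mono)
  then show sm: "summable (\<lambda>n. v n * htail a l n)"
    by (rule summable_comparison_test'[OF summable_mult2[OF v(2)]])
  let ?T = "\<lambda>n x. ennreal (\<phi> n (x 0)) * ennreal (log_kernel s n l x) * indicator (unit_cube l) x"
  have nonneg: "0 \<le> \<phi> n (x 0) * log_kernel s n l x" if "x \<in> unit_cube l" for n x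
    using \<phi>(2)[OF PiE_mem[OF that]] log_kernel_nonneg[OF that] by (intro mult_nonneg_nonneg) auto
  have meas: "?T n \<in> borel_measurable (lebesgue_pow l)" for n
    using \<phi>(1) by (intro measurable_cube_integrand) measurable
  show "has_bochner_integral (lebesgue_pow l) (\<lambda>x. indicator (unit_cube l) x *\<^sub>R g x)
      (\<Sum>n. v n * htail a l n)"
  proof (rule has_bochner_integral_nn_integral)
    show "(\<lambda>x. indicator (unit_cube l) x *\<^sub>R g x) \<in> borel_measurable (lebesgue_pow l)"
      using g(1) sets_unit_cube[of l] by measurable
    show "AE x in lebesgue_pow l. 0 \<le> indicator (unit_cube l) x *\<^sub>R g x"
      using g(2)
    proof eventually_elim
      case (elim x)
      show ?case
      proof (cases "x \<in> unit_cube l")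
        case True
        with elim have "(\<lambda>n. \<phi> n (x 0) * log_kernel s n l x) sums g x" by blast
        from sums_le[OF nonneg[OF True] sums_zero this] show ?thesis by simp
      qed simp
    qed
    show "0 \<le> (\<Sum>n. v n * htail a l n)"
      using sm h v(1) by (intro suminf_nonneg mult_nonneg_nonneg) auto
    have "(\<integral>\<^sup>+x. ennreal (indicator (unit_cube l) x *\<^sub>R g x) \<partial>lebesgue_pow l) =
        (\<integral>\<^sup>+x. (\<Sum>n. ?T n x) \<partial>lebesgue_pow l)"
      using g(2)
    proof (intro nn_integral_cong_AE, eventually_elim)
      case (elim x)
      show ?case
      proof (cases "x \<in> unit_cube l")
        case True
        then have "(\<Sum>n. ennreal (\<phi> n (x 0) * log_kernel s n l x)) = ennreal (g x)"
          using nonneg elim by (intro suminf_ennreal_eq) auto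
        then show ?thesis
          using True \<phi>(2)[OF PiE_mem[OF True]] log_kernel_nonneg[OF True] by (simp add: ennreal_mult)
      qed simp
    qed
    also have "\<dots> = (\<Sum>n. ennreal (v n) * ennreal (htail a l n))"
    proof (subst nn_integral_suminf[OF meas], intro suminf_cong)
      fix n
      have "(\<lambda>t. ennreal (\<phi> n t)) \<in> borel_measurable borel" using \<phi>(1) by measurable
      from nn_integral_log_kernel[OF this s a[unfolded a_def], of l n]
      show "integral\<^sup>N (lebesgue_pow l) (?T n) = ennreal (v n) * ennreal (htail a l n)"
        by (simp only: \<phi>(3) a_def)
    qed
    also have "\<dots> = ennreal (\<Sum>n. v n * htail a l n)"
      using h v(1) sm by (simp add: ennreal_mult[symmetric] suminf_ennreal2)
    finally show "(\<integral>\<^sup>+x. ennreal (indicator (unit_cube l) x *\<^sub>R g x) \<partial>lebesgue_pow l) =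
        ennreal (\<Sum>n. v n * htail a l n)" .
  qed
qed

text \<open>The case \<open>k = 0\<close> of \<open>sums_C\<close>, where \<open>esym\<close> is
  1.\<close>

lemma summable_arcsin_coeff:
  assumes "r = 1 \<or> r = 2"
  shows "summable (\<lambda>n. arcsin_coeff r n / real (2 * n + r))"
  using summable_mult[OF sums_summable[OF sums_C[OF assms, of 0]], of "1 / 2 ^ r"] by simp

text \<open>The factor \<open>real r ^ (2 * l + 2)\<close> combines r^(2l), from homogeneity of
  \<open>htail\<close> under the weights r^2 a_m, with r^2 from the coordinate \<open>x 0\<close>.
  The sign \<open>c\<close> makes the expansion nonnegative; as \<open>c * c = 1\<close>,
  multiplying by it again restores \<open>g\<close>.\<close>

lemma cube_integral_arcsin_series:
  assumes rs: "r = 1 \<and> s = 2 \<or> r = 2 \<and> s = 1"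
    and \<phi>: "\<And>n. \<phi> n \<in> borel_measurable borel" "\<And>n t. t \<in> {0..1} \<Longrightarrow> 0 \<le> \<phi> n t"
      "\<And>n. (\<integral>\<^sup>+t\<in>{0..1}. ennreal (\<phi> n t) \<partial>lborel) =
        ennreal (real r ^ 2 * (arcsin_coeff r n / real (2 * n + r)))"
    and g: "g \<in> borel_measurable (lebesgue_pow l)"
      "AE x in lebesgue_pow l. x \<in> unit_cube l \<longrightarrow> (\<lambda>n. \<phi> n (x 0) * log_kernel s n l x) sums (c * g x)"
    and c: "c * c = 1"
  shows "set_integrable (lebesgue_pow l) (unit_cube l) g"
    and "(LINT x:unit_cube l|lebesgue_pow l. g x) =
      c * real r ^ (2 * l + 2) * (\<Sum>n. arcsin_coeff r n / real (2 * n + r) * htail (inv_square r) l n)"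
    and "summable (\<lambda>n. arcsin_coeff r n / real (2 * n + r) * htail (inv_square r) l n)"
proof -
  define w where "w = (\<lambda>n. arcsin_coeff r n / real (2 * n + r))"
  have r: "r = 1 \<or> r = 2" and s: "1 \<le> s" and r0: "real r \<noteq> 0" using rs by auto
  have a: "(\<lambda>m. 1 / (real (s * m) + 1) ^ 2) = (\<lambda>m. real r ^ 2 * inv_square r m)"
  proof
    fix m
    have "(2 * real m + 2) ^ 2 = 4 * (real m + 1) ^ 2"
      by (simp add: power2_eq_square algebra_simps)
    with rs show "1 / (real (s * m) + 1) ^ 2 = real r ^ 2 * inv_square r m"
      by (auto simp: inv_square_def)
  qed
  have sa: "summable (\<lambda>m. 1 / (real (s * m) + 1) ^ 2)"
    unfolding a by (intro summable_mult summable_inv_square)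
  have h: "htail (\<lambda>m. 1 / (real (s * m) + 1) ^ 2) l n = real r ^ (2 * l) * htail (inv_square r) l n" for n
    unfolding a htail_scale[OF inv_square_nonneg summable_inv_square] by (simp add: power_mult)
  have w: "0 \<le> real r ^ 2 * w n" for n
    by (simp add: w_def arcsin_coeff_nonneg)
  have w': "summable (\<lambda>n. real r ^ 2 * w n)"
    unfolding w_def by (intro summable_mult summable_arcsin_coeff r)
  have \<phi>3: "(\<integral>\<^sup>+t\<in>{0..1}. ennreal (\<phi> n t) \<partial>lborel) = ennreal (real r ^ 2 * w n)" for n
    unfolding w_def by (rule \<phi>(3))
  have cg: "(\<lambda>x. c * g x) \<in> borel_measurable (lebesgue_pow l)" using g(1) by measurable
  note B = has_bochner_integral_log_kernel_series[OF s sa \<phi>(1,2) \<phi>3 w w' cg g(2)]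
  have e: "real r ^ 2 * w n * (real r ^ (2 * l) * htail (inv_square r) l n) =
      real r ^ (2 * l + 2) * (w n * htail (inv_square r) l n)" for n
    by (simp add: power_add power2_eq_square)
  have sm: "summable (\<lambda>n. real r ^ (2 * l + 2) * (w n * htail (inv_square r) l n))"
    using B(2) unfolding h e .
  with r0 have sm': "summable (\<lambda>n. w n * htail (inv_square r) l n)"
    by (auto simp only: summable_cmult_iff power_eq_0_iff)
  then show "summable (\<lambda>n. arcsin_coeff r n / real (2 * n + r) * htail (inv_square r) l n)"
    by (simp add: w_def)
  have "has_bochner_integral (lebesgue_pow l) (\<lambda>x. c * (indicator (unit_cube l) x *\<^sub>R (c * g x)))
      (c * (\<Sum>n. real r ^ (2 * l + 2) * (w n * htail (inv_square r) l n)))"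
    using B(1) unfolding h e by (rule has_bochner_integral_mult_right)
  also have "(\<lambda>x. c * (indicator (unit_cube l) x *\<^sub>R (c * g x))) = (\<lambda>x. indicator (unit_cube l) x *\<^sub>R g x)"
    using c by (auto simp: fun_eq_iff indicator_def mult.assoc[symmetric])
  finally have F: "has_bochner_integral (lebesgue_pow l) (\<lambda>x. indicator (unit_cube l) x *\<^sub>R g x)
      (c * (\<Sum>n. real r ^ (2 * l + 2) * (w n * htail (inv_square r) l n)))" .
  then show "set_integrable (lebesgue_pow l) (unit_cube l) g"
    unfolding set_integrable_def by (rule integrable.intros)
  show "(LINT x:unit_cube l|lebesgue_pow l. g x) =
      c * real r ^ (2 * l + 2) * (\<Sum>n. arcsin_coeff r n / real (2 * n + r) * htail (inv_square r) l n)"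
    unfolding set_lebesgue_integral_def has_bochner_integral_integral_eq[OF F]
    using suminf_mult[OF sm'] by (simp add: w_def)
qed

section \<open>Null hyperplanes, measurability and pointwise expansions of the integrands\<close>

lemma AE_lebesgue_pow_neq:
  assumes "i \<le> l"
  shows "AE x in lebesgue_pow l. x i \<noteq> c"
proof -
  interpret product_sigma_finite "\<lambda>_::nat. lborel :: real measure" by standard
  let ?N = "PiE {..l} (\<lambda>j. if j = i then {c} else UNIV)"
  have "emeasure (lebesgue_pow l) ?N = (\<Prod>j\<le>l. emeasure lborel (if j = i then {c} else UNIV))"
    by (rule emeasure_PiM) auto
  \<comment> \<open>One side has measure 0, which in \<open>ennreal\<close> annihilates the infinite
    measure of the others.\<close>
  also have "\<dots> = 0"
    using assms by (intro prod_zero) (auto intro!: bexI[of _ i])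
  finally have "?N \<in> null_sets (lebesgue_pow l)"
    by (auto intro!: null_setsI sets_PiM_I_finite)
  then show ?thesis
    by (rule AE_I') (auto simp: space_PiM PiE_iff extensional_def)
qed

lemma measurable_odd_integrand: "odd_integrand l \<in> borel_measurable (lebesgue_pow l)"
  unfolding odd_integrand_def[abs_def]
  by (intro borel_measurable_prod borel_measurable_times borel_measurable_divide borel_measurable_power
      borel_measurable_diff borel_measurable_const borel_measurable_ln borel_measurable_sqrt
      measurable_component_pow) auto

text \<open>Outside [-1, 1] the defining property is unsatisfiable, so \<open>arcsin\<close> takes
  one fixed unspecified value there: continuous on a closed set, constant off it.\<close>

lemma measurable_arcsin: "(arcsin :: real \<Rightarrow> real) \<in> borel_measurable borel"
proof -
  have out: "arcsin y = (THE x :: real. False)" if "y \<notin> {- 1..1}" for y :: real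
  proof -
    have "sin x \<noteq> y" for x using that sin_le_one[of x] sin_ge_minus_one[of x] by auto
    then show ?thesis by (simp add: arcsin_def)
  qed
  have "(\<lambda>y :: real. if y \<in> {- 1..1} then arcsin y else (THE x. False)) \<in> borel_measurable borel"
    by (intro borel_measurable_continuous_on_if) (auto intro!: continuous_intros)
  also have "(\<lambda>y :: real. if y \<in> {- 1..1} then arcsin y else (THE x. False)) = arcsin"
    using out by auto
  finally show ?thesis .
qed

lemma measurable_even_integrand: "even_integrand l \<in> borel_measurable (lebesgue_pow l)"
proof -
  have "(\<lambda>x. arcsin (sqrt (\<Prod>i=0..l. x i))) \<in> borel_measurable (lebesgue_pow l)"
    by (intro measurable_compose[OF _ measurable_arcsin] borel_measurable_sqrt borel_measurable_prod
        measurable_component_pow) auto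
  then show ?thesis
    unfolding even_integrand_def[abs_def]
    by (intro borel_measurable_prod borel_measurable_times borel_measurable_divide borel_measurable_power
        borel_measurable_diff borel_measurable_const borel_measurable_ln
        measurable_component_pow) auto
qed

text \<open>Isolates the dependence on \<open>n\<close> in a single power, which merges with the
  power of \<open>x 0\<close> into a power of the product of all coordinates.\<close>

lemma log_kernel_eq:
  "log_kernel s n l x = (\<Prod>i=1..l. x i) ^ (s * n) * ((-1) ^ l * (\<Prod>i=1..l. ln (x i) / (1 - (\<Prod>m=1..i. x m ^ s))))"
proof -
  have "log_kernel s n l x = (\<Prod>i=1..l. x i ^ (s * n) * ((- 1) * (ln (x i) / (1 - (\<Prod>m=1..i. x m ^ s)))))"
    unfolding log_kernel_def by (intro prod.cong refl) simp
  also have "\<dots> = (\<Prod>i=1..l. x i ^ (s * n)) * ((\<Prod>i=1..l. - 1) * (\<Prod>i=1..l. ln (x i) / (1 - (\<Prod>m=1..i. x m ^ s))))"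
    by (simp only: prod.distrib)
  also have "(\<Prod>i=1..l. x i ^ (s * n)) = (\<Prod>i=1..l. x i) ^ (s * n)"
    by (rule prod_power_distrib[symmetric])
  finally show ?thesis by simp
qed

text \<open>With P the product of all coordinates, this is sum b_n (2n+1) P^(2n) = 1/sqrt(1 - P^2).
  It holds at every point of the cube: zero denominators in the product over \<open>i\<close> occur
  identically on both sides.\<close>

lemma odd_integrand_sums:
  assumes "x \<in> unit_cube l"
  shows "(\<lambda>n. arcsin_coeff 1 n * real (2 * n + 1) * (x 0 ^ (2 * n) * (- ln (x 0))) * log_kernel 2 n l x)
    sums ((- 1) ^ (l + 1) * odd_integrand l x)"
proof -
  have x: "0 \<le> x i" "x i \<le> 1" if "i \<le> l" for i
    using PiE_mem[OF assms, of i] that by auto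
  define Q where "Q = (\<Prod>i=1..l. x i)"
  define P where "P = x 0 * Q"
  define R where "R = (-1) ^ l * (\<Prod>i=1..l. ln (x i) / (1 - (\<Prod>m=1..i. (x m)\<^sup>2)))"
  have Q: "0 \<le> Q" "Q \<le> 1" unfolding Q_def using x by (auto intro!: prod_nonneg prod_le_1)
  have P0: "0 \<le> P" "P \<le> x 0"
    unfolding P_def using Q x[of 0] by (auto intro: mult_left_le)
  have prod: "(\<Prod>i=0..l. (x i)\<^sup>2) = P\<^sup>2"
    unfolding P_def Q_def by (simp add: prod.atLeast_Suc_atMost power_mult_distrib prod_power_distrib)
  have odd: "(- 1) ^ (l + 1) * odd_integrand l x = - ln (x 0) / sqrt (1 - P\<^sup>2) * R"
    unfolding odd_integrand_def prod R_def by simp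
  have summand: "arcsin_coeff 1 n * real (2 * n + 1) * (x 0 ^ (2 * n) * (- ln (x 0))) * log_kernel 2 n l x
      = arcsin_coeff 1 n * real (2 * n + 1) * P ^ (2 * n) * (- ln (x 0) * R)" for n
    unfolding log_kernel_eq Q_def[symmetric] R_def[symmetric] P_def by (simp add: power_mult_distrib)
  show ?thesis
  proof (cases "x 0 = 1")
    \<comment> \<open>Here P may equal 1, but both sides vanish with \<open>ln 1 = 0\<close>;
      otherwise P is at most \<open>x 0\<close>, hence below 1.\<close>
    case True
    then show ?thesis unfolding odd summand by simp
  next
    case False
    with x[of 0] P0 have P: "0 \<le> P" "P < 1" by auto
    define u where "u = arcsin P"
    have u: "\<bar>u\<bar> < pi / 2" "sin u = P"
      using P arcsin_lt_bounded[of P] unfolding u_def by (auto simp: abs_less_iff)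
    have cos: "cos u = sqrt (1 - P\<^sup>2)" "0 < sqrt (1 - P\<^sup>2)"
      using P cos_arcsin[of P] unfolding u_def by (auto simp: abs_square_less_1)
    have "(\<lambda>n. arcsin_coeff 1 n * real (2 * n + 1) * P ^ (2 * n) * sqrt (1 - P\<^sup>2)) sums 1"
      using sums_arcsin(2)[of 1 u 0] u cos by simp
    from sums_mult2[OF this, of "1 / sqrt (1 - P\<^sup>2) * (- ln (x 0) * R)"] cos(2)
    show ?thesis unfolding odd summand by (simp add: mult_ac)
  qed
qed

text \<open>From arcsin^2(sqrt P)/2 = sum b_n P^(n+1), where the factors 1/x_i combine to 1/P. At
  \<open>x 0 = 0\<close>, for instance, the convention \<open>1 / 0 = 0\<close> makes the integrand
  0, while the term \<open>n = 0\<close> need not vanish.\<close>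

lemma even_integrand_sums:
  assumes "x \<in> unit_cube l" and "\<And>i. i \<le> l \<Longrightarrow> x i \<noteq> 0" and "x 0 \<noteq> 1"
  shows "(\<lambda>n. 2 * arcsin_coeff 2 n * x 0 ^ n * log_kernel 1 n l x) sums ((- 1) ^ l * even_integrand l x)"
proof -
  have x: "0 < x i" "x i \<le> 1" if "i \<le> l" for i
    using PiE_mem[OF assms(1), of i] assms(2)[OF that] that by auto
  define Q where "Q = (\<Prod>i=1..l. x i)"
  define P where "P = x 0 * Q"
  define R where "R = (-1) ^ l * (\<Prod>i=1..l. ln (x i) / (1 - (\<Prod>m=1..i. x m)))"
  have Q: "0 < Q" "Q \<le> 1"
    unfolding Q_def using x by (auto intro!: prod_pos prod_le_1 simp: less_imp_le)
  have "P \<le> x 0" unfolding P_def using Q x[of 0] by (auto intro: mult_left_le)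
  with x[of 0] \<open>x 0 \<noteq> 1\<close> have "P < 1" by simp
  moreover have "0 < P" using Q x[of 0] by (simp add: P_def)
  ultimately have P: "0 < P" "P < 1" by simp_all
  have prod: "(\<Prod>i=0..l. x i) = P"
    unfolding P_def Q_def by (simp add: prod.atLeast_Suc_atMost)
  have even: "(- 1) ^ l * even_integrand l x = (arcsin (sqrt P))\<^sup>2 / P * R"
    unfolding even_integrand_def prod R_def prod.distrib P_def
    by (simp add: Q_def prod_dividef field_simps)
  have summand: "2 * arcsin_coeff 2 n * x 0 ^ n * log_kernel 1 n l x = 2 * (arcsin_coeff 2 n * P ^ Suc n) * (R / P)" for n
  proof -
    have "log_kernel 1 n l x = Q ^ n * R" by (simp add: log_kernel_eq Q_def R_def)
    moreover have "x 0 ^ n * Q ^ n = P ^ n" by (simp add: P_def power_mult_distrib)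
    ultimately show ?thesis using P by (simp add: mult.assoc)
  qed
  define u where "u = arcsin (sqrt P)"
  have sP: "0 < sqrt P" "sqrt P < 1" using P by auto
  have "- 1 < sqrt P" using sP by linarith
  with sP arcsin_lt_bounded[of "sqrt P"] have "- (pi / 2) < u" "u < pi / 2" by (simp_all add: u_def)
  then have u: "\<bar>u\<bar> < pi / 2" by linarith
  have sin_u: "sin u = sqrt P"
    unfolding u_def using sP by (intro sin_arcsin) linarith+
  have "sqrt P ^ (2 * n + 2) = P ^ Suc n" for n
    using P by (simp add: power_add power_mult)
  then have "(\<lambda>n. arcsin_coeff 2 n * P ^ Suc n) sums (u ^ 2 / 2)"
    using sums_arcsin(1)[of 2 u 0] u sin_u by (simp add: fact_numeral power2_eq_square)
  from sums_mult2[OF sums_mult[OF this, of 2], of "R / P"] show ?thesis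
    unfolding even summand by (simp add: u_def)
qed

section \<open>Values of the cube integrals\<close>

lemma odd_integral:
  shows "set_integrable (lebesgue_pow l) (unit_cube l) (odd_integrand l)"
    and "(LINT x:unit_cube l|lebesgue_pow l. odd_integrand l x) =
      (-1) ^ (l + 1) * (\<Sum>n. arcsin_coeff 1 n / real (2 * n + 1) * htail (inv_square 1) l n)"
    and "summable (\<lambda>n. arcsin_coeff 1 n / real (2 * n + 1) * htail (inv_square 1) l n)"
proof -
  define \<phi> :: "nat \<Rightarrow> real \<Rightarrow> real" where
    "\<phi> = (\<lambda>n t. arcsin_coeff 1 n * real (2 * n + 1) * (t ^ (2 * n) * (- ln t)))"
  have 1: "\<phi> n \<in> borel_measurable borel" for n unfolding \<phi>_def by measurable
  have 2: "0 \<le> \<phi> n t" if "t \<in> {0..1}" for n t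
  proof -
    have "0 \<le> - ln t" using that by (cases "t = 0") auto
    then show ?thesis unfolding \<phi>_def by (intro mult_nonneg_nonneg arcsin_coeff_nonneg) (use that in auto)
  qed
  have 3: "(\<integral>\<^sup>+t\<in>{0..1}. ennreal (\<phi> n t) \<partial>lborel) =
      ennreal (real 1 ^ 2 * (arcsin_coeff 1 n / real (2 * n + 1)))" for n
  proof -
    let ?c = "arcsin_coeff 1 n * real (2 * n + 1)"
    have c: "0 \<le> ?c" using arcsin_coeff_nonneg[of 1 n] by simp
    have "(\<integral>\<^sup>+t\<in>{0..1}. ennreal (\<phi> n t) \<partial>lborel) =
        (\<integral>\<^sup>+t. ennreal ?c * (ennreal (t ^ (2 * n) * (- ln t)) * indicator {0..1} t) \<partial>lborel)"
      unfolding \<phi>_def ennreal_mult'[OF c] by (simp only: mult.assoc)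
    also have "\<dots> = ennreal (?c * (1 / (real (2 * n) + 1) ^ 2))"
      using c by (subst nn_integral_cmult) (simp_all only: nn_integral_power_ln ennreal_mult'[OF c], measurable)
    \<comment> \<open>One factor 2n+1 from differentiating against two from the logarithmic
      integral.\<close>
    also have "?c * (1 / (real (2 * n) + 1) ^ 2) = real 1 ^ 2 * (arcsin_coeff 1 n / real (2 * n + 1))"
      by (simp add: power2_eq_square add.commute)
    finally show ?thesis .
  qed
  have 4: "AE x in lebesgue_pow l. x \<in> unit_cube l \<longrightarrow>
      (\<lambda>n. \<phi> n (x 0) * log_kernel 2 n l x) sums ((-1) ^ (l + 1) * odd_integrand l x)"
    using odd_integrand_sums unfolding \<phi>_def by (intro AE_I2) blast
  have 5: "((-1) ^ (l + 1)) * ((-1) ^ (l + 1)) = (1::real)"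
    by (simp flip: power_add add: mult_2[symmetric])
  note * = cube_integral_arcsin_series[of 1 2, OF _ 1 2 3 measurable_odd_integrand 4 5, simplified]
  show "set_integrable (lebesgue_pow l) (unit_cube l) (odd_integrand l)"
    and "(LINT x:unit_cube l|lebesgue_pow l. odd_integrand l x) =
      (-1) ^ (l + 1) * (\<Sum>n. arcsin_coeff 1 n / real (2 * n + 1) * htail (inv_square 1) l n)"
    and "summable (\<lambda>n. arcsin_coeff 1 n / real (2 * n + 1) * htail (inv_square 1) l n)"
    using * by simp_all
qed

lemma even_integral:
  shows "set_integrable (lebesgue_pow l) (unit_cube l) (even_integrand l)"
    and "(LINT x:unit_cube l|lebesgue_pow l. even_integrand l x) =
      (-1) ^ l * 2 ^ (2 * l + 2) * (\<Sum>n. arcsin_coeff 2 n / real (2 * n + 2) * htail (inv_square 2) l n)"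
    and "summable (\<lambda>n. arcsin_coeff 2 n / real (2 * n + 2) * htail (inv_square 2) l n)"
proof -
  define \<phi> :: "nat \<Rightarrow> real \<Rightarrow> real" where "\<phi> = (\<lambda>n t. 2 * arcsin_coeff 2 n * t ^ n)"
  have 1: "\<phi> n \<in> borel_measurable borel" for n unfolding \<phi>_def by measurable
  have 2: "0 \<le> \<phi> n t" if "t \<in> {0..1}" for n t
    unfolding \<phi>_def using that arcsin_coeff_nonneg[of 2 n] by auto
  have 3: "(\<integral>\<^sup>+t\<in>{0..1}. ennreal (\<phi> n t) \<partial>lborel) =
      ennreal (real 2 ^ 2 * (arcsin_coeff 2 n / real (2 * n + 2)))" for n
  proof -
    have "(\<integral>\<^sup>+t\<in>{0..1}. ennreal (\<phi> n t) \<partial>lborel) =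
        ennreal (2 * arcsin_coeff 2 n * (1 ^ Suc n / real (Suc n)) - 2 * arcsin_coeff 2 n * (0 ^ Suc n / real (Suc n)))"
    proof (rule nn_integral_FTC_Icc[OF 1])
      fix t :: real assume t: "t \<in> {0..1}"
      show "((\<lambda>t. 2 * arcsin_coeff 2 n * (t ^ Suc n / real (Suc n))) has_real_derivative \<phi> n t) (at t)"
        unfolding \<phi>_def by (rule derivative_eq_intros refl | simp)+
      show "0 \<le> \<phi> n t" using t by (rule 2)
    qed simp
    also have "2 * arcsin_coeff 2 n * (1 ^ Suc n / real (Suc n)) - 2 * arcsin_coeff 2 n * (0 ^ Suc n / real (Suc n))
        = real 2 ^ 2 * (arcsin_coeff 2 n / real (2 * n + 2))"
      by (simp add: field_simps)
    finally show ?thesis .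
  qed
  have "AE x in lebesgue_pow l. \<forall>i\<in>{..l}. x i \<noteq> 0"
    by (intro AE_finite_allI AE_lebesgue_pow_neq) auto
  moreover have "AE x in lebesgue_pow l. x 0 \<noteq> 1" by (rule AE_lebesgue_pow_neq) simp
  ultimately have 4: "AE x in lebesgue_pow l. x \<in> unit_cube l \<longrightarrow>
      (\<lambda>n. \<phi> n (x 0) * log_kernel 1 n l x) sums ((-1) ^ l * even_integrand l x)"
    by eventually_elim (use even_integrand_sums in \<open>auto simp: \<phi>_def\<close>)
  have 5: "((-1) ^ l) * ((-1) ^ l) = (1::real)"
    by (simp flip: power_add add: mult_2[symmetric])
  note * = cube_integral_arcsin_series[of 2 1, OF _ 1 2 3 measurable_even_integrand 4 5]
  show "set_integrable (lebesgue_pow l) (unit_cube l) (even_integrand l)"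
    and "(LINT x:unit_cube l|lebesgue_pow l. even_integrand l x) =
      (-1) ^ l * 2 ^ (2 * l + 2) * (\<Sum>n. arcsin_coeff 2 n / real (2 * n + 2) * htail (inv_square 2) l n)"
    and "summable (\<lambda>n. arcsin_coeff 2 n / real (2 * n + 2) * htail (inv_square 2) l n)"
    using * by simp_all
qed

section \<open>Combining the cotangent and cube series\<close>

lemma C_eq_sum_htail:
  assumes r: "r = 1 \<or> r = 2"
    and sm: "\<And>l. l \<le> k \<Longrightarrow> summable (\<lambda>n. arcsin_coeff r n / real (2 * n + r) * htail (inv_square r) l n)"
  shows "C (2 * k + r) = (\<Sum>l=0..k. 2 ^ (2 * l + r) * (-1) ^ l * (pi ^ (2 * k - 2 * l) * fact (r - 1) / fact (2 * k - 2 * l + r - 1))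
    * (\<Sum>n. arcsin_coeff r n / real (2 * n + r) * htail (inv_square r) l n))"
proof -
  define A where "A = (\<lambda>j. (pi / 2) ^ (2 * j) * fact (r - 1) / fact (2 * j + r - 1))"
  define w where "w = (\<lambda>n. arcsin_coeff r n / real (2 * n + r))"
  have lim: "esym (inv_square r) j \<longlonglongrightarrow> A j" for j
    unfolding A_def by (rule esym_inv_square_tendsto[OF r])
  have "C (2 * k + r) = (\<Sum>n. 2 ^ (2 * k + r) * (w n * esym (inv_square r) k n))"
    using sums_unique[OF sums_C[OF r, of k]] by (simp add: w_def)
  also have "\<dots> = (\<Sum>n. \<Sum>l\<le>k. 2 ^ (2 * k + r) * (-1) ^ l * A (k - l) * (w n * htail (inv_square r) l n))"
    \<comment> \<open>Each \<open>esym\<close> is replaced by its finite alternating sum, which then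
      commutes with the series over \<open>n\<close>.\<close>
    unfolding sum_htail_eq_esym[OF inv_square_nonneg summable_inv_square lim, symmetric]
    by (simp add: sum_distrib_left mult_ac)
  also have "\<dots> = (\<Sum>l\<le>k. \<Sum>n. 2 ^ (2 * k + r) * (-1) ^ l * A (k - l) * (w n * htail (inv_square r) l n))"
    using sm by (intro suminf_sum summable_mult) (simp add: w_def)
  also have "\<dots> = (\<Sum>l\<le>k. 2 ^ (2 * k + r) * (-1) ^ l * A (k - l) * (\<Sum>n. w n * htail (inv_square r) l n))"
    using sm by (intro sum.cong refl suminf_mult) (simp add: w_def)
  also have "\<dots> = (\<Sum>l\<le>k. 2 ^ (2 * l + r) * (-1) ^ l * (pi ^ (2 * k - 2 * l) * fact (r - 1) / fact (2 * k - 2 * l + r - 1))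
      * (\<Sum>n. w n * htail (inv_square r) l n))"
  proof (intro sum.cong refl, goal_cases)
    case (1 l)
    \<comment> \<open>The surplus power 4^(k-l) cancels the denominator of (pi/2)^(2(k-l)) in
      \<open>A (k - l)\<close>.\<close>
    then have "2 * k + r = (2 * l + r) + 2 * (k - l)" by auto
    then have "(2::real) ^ (2 * k + r) = 2 ^ (2 * l + r) * 2 ^ (2 * (k - l))"
      by (metis power_add)
    then show ?case by (simp add: A_def power_divide right_diff_distrib')
  qed
  finally show ?thesis by (simp add: w_def atLeast0AtMost)
qed

theorem theorem2:
  fixes k :: nat
  shows "(\<forall>m\<ge>1. set_integrable lborel {0..pi} (\<lambda>\<theta>. \<theta> ^ m / 2 * cot (\<theta> / 2)))
    \<and> (\<forall>l\<le>k. set_integrable (lebesgue_pow l) (unit_cube l) (odd_integrand l))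
    \<and> (\<forall>l\<le>k. set_integrable (lebesgue_pow l) (unit_cube l) (even_integrand l))
    \<and> C (2 * k + 1) =
        - (\<Sum>l=0..k. 2 ^ (2 * l + 1) * (pi ^ (2 * k - 2 * l) / fact (2 * k - 2 * l))
             * (LINT x:unit_cube l|lebesgue_pow l. odd_integrand l x))
    \<and> C (2 * k + 2) =
        (\<Sum>l=0..k. pi ^ (2 * k - 2 * l) / fact (2 * k - 2 * l + 1)
             * (LINT x:unit_cube l|lebesgue_pow l. even_integrand l x))"
proof (intro conjI allI impI)
  show "set_integrable lborel {0..pi} (\<lambda>\<theta>. \<theta> ^ m / 2 * cot (\<theta> / 2))" if "1 \<le> m" for m
    by (rule set_integrable_power_cot[OF that])
  show "set_integrable (lebesgue_pow l) (unit_cube l) (odd_integrand l)"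
    "set_integrable (lebesgue_pow l) (unit_cube l) (even_integrand l)" for l
    by (rule odd_integral even_integral)+
  show "C (2 * k + 1) =
        - (\<Sum>l=0..k. 2 ^ (2 * l + 1) * (pi ^ (2 * k - 2 * l) / fact (2 * k - 2 * l))
             * (LINT x:unit_cube l|lebesgue_pow l. odd_integrand l x))"
    \<comment> \<open>The sign (-1)^(l+1) of the cube integral meets (-1)^l and leaves the overall
      minus; the power of 2 stays outside.\<close>
    unfolding odd_integral(2) by (subst C_eq_sum_htail)
      (auto simp: odd_integral(3)[simplified] sum_negf[symmetric] intro!: sum.cong)
  show "C (2 * k + 2) =
        (\<Sum>l=0..k. pi ^ (2 * k - 2 * l) / fact (2 * k - 2 * l + 1)
             * (LINT x:unit_cube l|lebesgue_pow l. even_integrand l x))"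
    \<comment> \<open>The cube integral already contains (-1)^l 2^(2l+2), exactly the factor in the
      sum, so neither sign nor power of 2 remains.\<close>
    unfolding even_integral(2) by (subst C_eq_sum_htail)
      (auto simp: even_integral(3)[simplified] intro!: sum.cong)
qed

end
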